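(* Let $\{\omega(z), z\in\mathbb{N}^2\}$ be i.i.d. exponential random variables with parameter $1$, with joint law $\mathbb{P}$ on $\Omega=[0,\infty)^{\mathbb{N}^2}$, and let $\mathcal{T}$ be the geodesic tree of the associated directed last-passage percolation model. For every positive integer $n$, $n$-coexistence occurs with positive probability; that is, with positive $\mathbb{P}$-probability the vertex sets of the $n$ subtrees $\mathcal{T}_{(0,n-1)},\mathcal{T}_{(1,n-2)},\ldots,\mathcal{T}_{(n-1,0)}$ are simultaneously unbounded.
   Context: Here $\mathbb{N}=\{0,1,2,\ldots\}$. A directed path from $(0,0)$ to $z\in\mathbb{N}^2$ is a finite sequence of sites $(z_0,z_1,\ldots,z_k)$ of $\mathbb{N}^2$ with $z_0=(0,0)$, $z_k=z$ and $z_{i+1}-z_i\in\{(1,0),(0,1)\}$ for $0\le i\le k-1$. Let $\Gamma(z)$ be the set of all directed paths from $(0,0)$ to $z$. The last-passage time to $z$ is $G(z)=\max_{\gamma\in\Gamma(z)}\sum_{z'\in\gamma}\omega(z')$. Almost surely, for every $z$, the maximum is reached by exactly one path, denoted $\gamma_z$ and called the geodesic to $z$. The geodesic tree $\mathcal{T}$ is the tree rooted at the origin, with vertex set $\mathbb{N}^2$, whose edges are the pairs $\{z',z\}$ with $z-z'\in\{(1,0),(0,1)\}$ and $z'\in\gamma_z$. For $z\in\mathbb{N}^2$, $\mathcal{T}_z$ is the subtree of $\mathcal{T}$ rooted at $z$: the collection of geodesics passing by $z$, from which the common part from the origin to $z$ is deleted; its vertex set is $\{z'\in\mathbb{N}^2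 : z\in\gamma_{z'}\}$. *)

theory Defs
  imports "HOL-Probability.Probability"
begin

type_synonym site = "nat \<times> nat"

definition directed_paths :: "site \<Rightarrow> site list set" where
  "directed_paths z =
     {p. p \<noteq> [] \<and> hd p = (0, 0) \<and> last p = z \<and>
         (\<forall>i. Suc i < length p \<longrightarrow>
            p ! Suc i = p ! i + (1, 0) \<or> p ! Suc i = p ! i + (0, 1))}"

definition passage_time :: "(site \<Rightarrow> real) \<Rightarrow> site list \<Rightarrow> real" where
  "passage_time \<omega> p = (\<Sum>z\<in>set p. \<omega> z)"

definition last_passage_time :: "(site \<Rightarrow> real) \<Rightarrow> site \<Rightarrow> real" where
  "last_passage_time \<omega> z = Max (passage_time \<omega> ` directed_paths z)"

text \<open>Under \<open>lpp_measure\<close> below, the maximising path is almost surely unique for every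
  site; on the exceptional null set the value of \<open>geodesic\<close> is unspecified.\<close>

definition geodesic :: "(site \<Rightarrow> real) \<Rightarrow> site \<Rightarrow> site list" where
  "geodesic \<omega> z =
     (THE p. p \<in> directed_paths z \<and> passage_time \<omega> p = last_passage_time \<omega> z)"

definition subtree_vertices :: "(site \<Rightarrow> real) \<Rightarrow> site \<Rightarrow> site set" where
  "subtree_vertices \<omega> z = {z'. z \<in> set (geodesic \<omega> z')}"

definition embed :: "site \<Rightarrow> real \<times> real" where
  "embed z = (real (fst z), real (snd z))"

definition coexistence :: "nat \<Rightarrow> (site \<Rightarrow> real) \<Rightarrow> bool" where
  "coexistence n \<omega> \<longleftrightarrow> (\<forall>i<n. \<not> bounded (embed ` subtree_vertices \<omega> (i, n - 1 - i)))"

definition exp1_measure :: "real measure" where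
  "exp1_measure =
     restrict_space (density lborel (\<lambda>x. ennreal (exponential_density 1 x))) {0..}"

definition lpp_measure :: "(site \<Rightarrow> real) measure" where
  "lpp_measure = PiM UNIV (\<lambda>_. exp1_measure)"

lemma prob_space_exp1_measure: "prob_space exp1_measure"
proof -
  let ?D = "density lborel (\<lambda>x. ennreal (exponential_density 1 x))"
  interpret D: prob_space ?D
    by (rule prob_space_exponential_density) simp
  have "AE x in ?D. x \<in> {0..}"
    by (subst AE_density) (auto simp: exponential_density_def)
  then have "emeasure ?D {0..} = 1"
    by (intro D.emeasure_eq_1_AE) auto
  then show ?thesis
    unfolding exp1_measure_def by (intro prob_space_restrict_space) auto
qed

lemma space_lpp_measure: "space lpp_measure = {\<omega>. \<forall>z. 0 \<le> \<omega> z}"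
  by (auto simp: lpp_measure_def exp1_measure_def space_PiM space_restrict_space PiE_def Pi_def)

lemma prob_space_lpp_measure: "prob_space lpp_measure"
  unfolding lpp_measure_def by (intro prob_space_PiM prob_space_exp1_measure)

end

theory Submission
  imports Defs
begin

text \<open>Among the paths to a target \<open>z\<close>, let \<open>D(v, z)\<close> be the last-passage time from \<open>v\<close> to \<open>z\<close> without
  the weight of \<open>v\<close>. If the \<open>n\<close> sites \<open>v\<^sub>0, \<dots>, v\<^sub>n\<^sub>-\<^sub>1\<close> of the antidiagonal carry heights \<open>h\<^sub>a\<close> and the
  weights below are small, then the geodesic to \<open>z\<close> starts through the site maximising \<open>h\<^sub>a + D(v\<^sub>a, z)\<close>,
  and the heights are independent of the \<open>D(v\<^sub>a, z)\<close>. So it suffices to find targets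
  \<open>z\<^sub>0, \<dots>, z\<^sub>n\<^sub>-\<^sub>1\<close> arbitrarily far away such that, with probability at least \<open>1/2\<close>, all the gaps
  \<open>D(v\<^sub>a\<^sub>+\<^sub>1, z\<^sub>i) - D(v\<^sub>a, z\<^sub>i)\<close> lie in an interval \<open>(A\<^sub>i, B\<^sub>i)\<close>, with \<open>B\<^sub>i\<close> well below \<open>A\<^sub>i\<^sub>+\<^sub>1\<close>: the
  heights are then chosen concave with slopes separating these intervals.

  Choosing \<open>z\<^sub>i\<close> in a direction closer to the horizontal axis makes the gaps large: there the expected
  cost of a step to the right is nearly the mean weight 1, so that geodesics almost follow the rows and
  the gap dominates the maximum of a long mean-zero random walk comparing two adjacent rows. The
  upper end \<open>B\<^sub>i\<close> comes from Markov's inequality, the expected increments of the last-passage time being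
  bounded on average by a linear bound on its mean.\<close>

section \<open>Mean-zero random walks\<close>

text \<open>The density is positive everywhere, so no upper tail is a null set.\<close>

lemma cdf_std_normal_less_1: "cdf std_normal_distribution x < 1"
proof -
  interpret N: real_distribution std_normal_distribution by (rule real_dist_normal_dist)
  have "0 < emeasure std_normal_distribution {x<..}"
  proof (rule ccontr)
    assume "\<not> ?thesis"
    then have "(\<integral>\<^sup>+y. ennreal (std_normal_density y) * indicator {x<..} y \<partial>lborel) = 0"
      by (simp add: emeasure_density)
    then have "AE y in lborel. ennreal (std_normal_density y) * indicator {x<..} y = 0"
      by (subst (asm) nn_integral_0_iff_AE) auto
    then have "AE y in lborel. y \<notin> {x<..}"
    proof eventually_elim
      fix y assume "ennreal (std_normal_density y) * indicator {x<..} y = 0"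
      moreover have "0 < std_normal_density y" by (rule normal_density_pos) simp
      ultimately show "y \<notin> {x<..}" by (auto simp: ennreal_eq_0_iff)
    qed
    then have "emeasure lborel {x<..} = 0"
      by (subst (asm) AE_iff_measurable[of "{x<..}"]) auto
    moreover have "emeasure lborel {x<..x + 1} \<le> emeasure lborel {x<..}"
      by (intro emeasure_mono) auto
    ultimately show False by simp
  qed
  then have "0 < measure std_normal_distribution {x<..}"
    by (simp add: N.emeasure_eq_measure)
  moreover have "measure std_normal_distribution {x<..} = 1 - measure std_normal_distribution {..x}"
    using N.prob_compl[of "{..x}"] by (simp add: Compl_eq_Diff_UNIV[symmetric])
  ultimately show ?thesis by (simp add: cdf_def)
qed

lemma isCont_cdf_std_normal: "isCont (cdf std_normal_distribution) x"
proof -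
  interpret N: real_distribution std_normal_distribution by (rule real_dist_normal_dist)
  have "emeasure std_normal_distribution {x} = 0"
    by (subst emeasure_density) (auto simp: nn_integral_0_iff_AE intro: AE_mp[OF AE_lborel_singleton[of x]])
  then show ?thesis by (simp add: N.isCont_cdf measure_def)
qed

text \<open>Half of the Gaussian tail beyond 1: halving leaves room for a limit of probabilities to
  give a bound at a finite time.\<close>

definition clt_gap :: real where
  "clt_gap = (1 - cdf std_normal_distribution 1) / 2"

lemma clt_gap: "0 < clt_gap"
  using cdf_std_normal_less_1[of 1] by (simp add: clt_gap_def)

context prob_space
begin

lemma prob_indep_var:
  assumes "indep_var N1 X N2 Y" "A \<in> sets N1" "B \<in> sets N2"
  shows "\<P>(x in M. X x \<in> A \<and> Y x \<in> B) = \<P>(x in M. X x \<in> A) * \<P>(x in M. Y x \<in> B)"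
proof -
  have "(\<lambda>x. (X x, Y x)) -` (A \<times> B) \<inter> space M = {x\<in>space M. X x \<in> A \<and> Y x \<in> B}"
    "X -` A \<inter> space M = {x\<in>space M. X x \<in> A}" "Y -` B \<inter> space M = {x\<in>space M. Y x \<in> B}"
    by auto
  then show ?thesis using indep_varD[OF assms] by simp
qed

text \<open>By the central limit theorem the normalised walk exceeds 1 with probability tending to
  \<open>2 * clt_gap\<close>. Once the normalising factor is at least \<open>Q\<close>, the walk
  itself then exceeds \<open>Q\<close>. The lower bound is the same for all
  \<open>Q\<close>.\<close>

lemma random_walk_large_with_positive_probability:
  fixes X :: "nat \<Rightarrow> 'a \<Rightarrow> real" and \<sigma> Q :: real
  assumes indep: "indep_vars (\<lambda>i. borel) X UNIV"
    and mean: "\<And>n. expectation (X n) = 0"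
    and \<sigma>: "\<sigma> > 0"
    and square: "\<And>n. integrable M (\<lambda>x. (X n x)\<^sup>2)"
    and var: "\<And>n. variance (X n) = \<sigma>\<^sup>2"
    and distr: "\<And>n. distr M borel (X n) = \<mu>"
  shows "\<exists>k. clt_gap \<le> \<P>(x in M. Q < (\<Sum>i<k. X i x))"
proof -
  have X[measurable]: "X n \<in> borel_measurable M" for n
    using indep unfolding indep_vars_def2 by simp
  let ?T = "\<lambda>n x. (\<Sum>i<n. X i x) / sqrt (n * \<sigma>\<^sup>2)"
  have "weak_conv_m (\<lambda>n. distr M borel (?T n)) std_normal_distribution"
    by (rule central_limit_theorem_zero_mean[OF indep mean \<sigma> square var distr])
  then have "(\<lambda>n. cdf (distr M borel (?T n)) 1) \<longlonglongrightarrow> cdf std_normal_distribution 1"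
    using isCont_cdf_std_normal unfolding weak_conv_m_def weak_conv_def by blast
  then have "eventually (\<lambda>n. cdf (distr M borel (?T n)) 1 < 1 - clt_gap) sequentially"
    by (rule order_tendstoD) (use cdf_std_normal_less_1[of 1] in \<open>simp add: clt_gap_def field_simps\<close>)
  moreover have "filterlim (\<lambda>n. sqrt (real n * \<sigma>\<^sup>2)) at_top sequentially"
    using \<sigma> by (intro filterlim_compose[OF sqrt_at_top] filterlim_at_top_mult_tendsto_pos[OF tendsto_const]
        filterlim_real_sequentially) simp
  \<comment> \<open>The maximum with 1 keeps the normalising factor positive when \<open>Q\<close>
    is not.\<close>
  then have "eventually (\<lambda>n. max Q 1 \<le> sqrt (real n * \<sigma>\<^sup>2)) sequentially"
    unfolding filterlim_at_top by blast
  ultimately have "eventually (\<lambda>n. cdf (distr M borel (?T n)) 1 < 1 - clt_gap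
    \<and> max Q 1 \<le> sqrt (real n * \<sigma>\<^sup>2)) sequentially"
    by (rule eventually_conj)
  then obtain n where n: "cdf (distr M borel (?T n)) 1 < 1 - clt_gap" "max Q 1 \<le> sqrt (real n * \<sigma>\<^sup>2)"
    by (auto simp: eventually_sequentially)
  have "cdf (distr M borel (?T n)) 1 = \<P>(x in M. ?T n x \<le> 1)"
    by (auto simp: cdf_def measure_distr intro!: arg_cong[where f=prob])
  then have "clt_gap \<le> 1 - \<P>(x in M. ?T n x \<le> 1)" using n(1) by simp
  also have "\<dots> = \<P>(x in M. \<not> ?T n x \<le> 1)"
    by (rule prob_neg[symmetric]) measurable
  also have "\<dots> \<le> \<P>(x in M. Q < (\<Sum>i<n. X i x))"
    using n(2) by (intro finite_measure_mono) (auto simp: not_le less_divide_eq)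
  finally show ?thesis by blast
qed

text \<open>Given that the walk has stayed below \<open>R\<close> up to time \<open>l\<close>, it exceeds \<open>R\<close> shortly after with a
  probability bounded from below; hence the limit of the probabilities of staying below \<open>R\<close> is
  multiplied by a factor smaller than 1.\<close>

lemma random_walk_exceeds:
  fixes X :: "nat \<Rightarrow> 'a \<Rightarrow> real" and \<sigma> R \<epsilon> :: real
  assumes indep: "indep_vars (\<lambda>i. borel) X UNIV"
    and mean: "\<And>n. expectation (X n) = 0"
    and \<sigma>: "\<sigma> > 0"
    and square: "\<And>n. integrable M (\<lambda>x. (X n x)\<^sup>2)"
    and var: "\<And>n. variance (X n) = \<sigma>\<^sup>2"
    and distr: "\<And>n. distr M borel (X n) = \<mu>"
    and \<epsilon>: "0 < \<epsilon>"
  shows "\<exists>l. \<P>(x in M. \<forall>k\<le>l. (\<Sum>i<k. X i x) \<le> R) < \<epsilon>"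
proof -
  have X[measurable]: "X n \<in> borel_measurable M" for n
    using indep unfolding indep_vars_def2 by simp
  define p where "p l = \<P>(x in M. \<forall>k\<le>l. (\<Sum>i<k. X i x) \<le> R)" for l
  have step: "\<exists>k. p (l + k) \<le> (1 - clt_gap) * p l + \<delta>" if "0 < \<delta>" for l \<delta>
  proof -
    define S where "S x = (\<Sum>i<l. X i x)" for x
    have S[measurable]: "S \<in> borel_measurable M" unfolding S_def by measurable
    have Si: "integrable M S"
      unfolding S_def by (auto intro!: Bochner_Integration.integrable_sum square_integrable_imp_integrable square)
    \<comment> \<open>Markov's inequality gives \<open>\<bar>S\<bar> \<ge> Q\<close> probability at
      most \<delta>; adding 1 keeps \<open>Q\<close> positive when the expectation vanishes.\<close>
    define Q where "Q = expectation (\<lambda>x. \<bar>S x\<bar>) / \<delta> + 1"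
    have E: "0 \<le> expectation (\<lambda>x. \<bar>S x\<bar>)" by simp
    then have Q: "0 < Q" using that by (simp add: Q_def add_nonneg_pos)
    have "\<P>(x in M. \<bar>S x\<bar> \<ge> Q) \<le> expectation (\<lambda>x. \<bar>S x\<bar>) / Q"
      using Q Si by (intro integral_Markov_inequality_measure[where A="{}"]) auto
    also have "\<dots> \<le> \<delta>"
    proof -
      have "\<delta> * Q = expectation (\<lambda>x. \<bar>S x\<bar>) + \<delta>" using that by (simp add: Q_def field_simps)
      with that Q show ?thesis by (simp add: divide_le_eq)
    qed
    finally have tail: "\<P>(x in M. \<bar>S x\<bar> \<ge> Q) \<le> \<delta>" .
    have indep': "indep_vars (\<lambda>i. borel) (\<lambda>i. X (l + i)) UNIV"
    proof -
      have "indep_vars (\<lambda>i. PiM {l + i} (\<lambda>_. borel)) (\<lambda>i x. restrict (\<lambda>j. X j x) {l + i}) UNIV"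
        by (rule indep_vars_restrict[OF indep]) (auto simp: disjoint_family_on_def)
      from indep_vars_compose2[OF this, of "\<lambda>i v. v (l + i)" "\<lambda>_. borel"] show ?thesis
        by (simp add: measurable_component_singleton)
    qed
    from random_walk_large_with_positive_probability[OF indep' mean \<sigma> square var distr, of "Q + R"]
    obtain k where k: "clt_gap \<le> \<P>(x in M. Q + R < (\<Sum>i<k. X (l + i) x))" by blast
    define Y where "Y x = (\<Sum>i<k. X (l + i) x)" for x
    have Y[measurable]: "Y \<in> borel_measurable M" unfolding Y_def by measurable
    \<comment> \<open>The past up to time \<open>l\<close> and the later increments are events on
      disjoint blocks of indices, hence independent.\<close>
    define A where "A = {v\<in>space (PiM {..<l} (\<lambda>_. borel :: real measure)). \<forall>k\<in>{..l}. (\<Sum>i<k. v i) \<le> R}"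
    define B where "B = {v\<in>space (PiM {l..<l + k} (\<lambda>_. borel :: real measure)). (\<Sum>i<k. v (l + i)) \<le> Q + R}"
    have coord: "(\<lambda>v. v i) \<in> borel_measurable (PiM I (\<lambda>_. borel :: real measure))" if "i \<in> I" for i and I :: "nat set"
      by (rule measurable_component_singleton[OF that])
    have AB: "A \<in> sets (PiM {..<l} (\<lambda>_. borel))" "B \<in> sets (PiM {l..<l + k} (\<lambda>_. borel))"
      unfolding A_def B_def
      by (auto intro!: sets.sets_Collect_finite_All borel_measurable_le borel_measurable_sum coord)
    have A: "restrict (\<lambda>i. X i x) {..<l} \<in> A \<longleftrightarrow> (\<forall>k\<le>l. (\<Sum>i<k. X i x) \<le> R)" for x
    proof -
      have "(\<Sum>i<k. restrict (\<lambda>i. X i x) {..<l} i) = (\<Sum>i<k. X i x)" if "k \<le> l" for k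
        using that by (intro sum.cong) auto
      then show ?thesis by (simp add: A_def space_PiM Ball_def)
    qed
    have B: "restrict (\<lambda>i. X i x) {l..<l + k} \<in> B \<longleftrightarrow> Y x \<le> Q + R" for x
      by (simp add: B_def space_PiM Y_def)
    have "indep_var (PiM {..<l} (\<lambda>_. borel)) (\<lambda>x. restrict (\<lambda>i. X i x) {..<l})
        (PiM {l..<l + k} (\<lambda>_. borel)) (\<lambda>x. restrict (\<lambda>i. X i x) {l..<l + k})"
      by (rule indep_var_restrict[OF indep]) auto
    from prob_indep_var[OF this AB]
    have "\<P>(x in M. (\<forall>k\<le>l. (\<Sum>i<k. X i x) \<le> R) \<and> Y x \<le> Q + R)
      = p l * \<P>(x in M. Y x \<le> Q + R)"
      unfolding A B p_def .
    also have "\<dots> \<le> p l * (1 - clt_gap)"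
    proof (intro mult_left_mono)
      have "\<P>(x in M. \<not> Q + R < Y x) = 1 - \<P>(x in M. Q + R < Y x)"
        by (rule prob_neg) measurable
      then show "\<P>(x in M. Y x \<le> Q + R) \<le> 1 - clt_gap"
        using k by (simp add: Y_def not_less)
    qed (simp add: p_def)
    finally have ind: "\<P>(x in M. (\<forall>k\<le>l. (\<Sum>i<k. X i x) \<le> R) \<and> Y x \<le> Q + R) \<le> (1 - clt_gap) * p l"
      by (simp add: mult.commute)
    have "(\<Sum>i<l + k. X i x) = (\<Sum>i<l. X i x) + (\<Sum>i<k. X (l + i) x)" for x k
      by (induction k) (simp_all add: add.assoc)
    then have split: "(\<Sum>i<l + k. X i x) = S x + Y x" for x
      by (simp add: S_def Y_def)
    \<comment> \<open>If the walk stays below \<open>R\<close>, then \<open>S + Y \<le> R\<close>: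
      either \<open>Y \<le> Q + R\<close>, or \<open>S < - Q\<close>, which is the tail
      event.\<close>
    have "p (l + k) \<le> prob ({x\<in>space M. (\<forall>k\<le>l. (\<Sum>i<k. X i x) \<le> R) \<and> Y x \<le> Q + R}
        \<union> {x\<in>space M. \<bar>S x\<bar> \<ge> Q})"
      unfolding p_def
    proof (intro finite_measure_mono subsetI)
      fix x assume x: "x \<in> {x \<in> space M. \<forall>j\<le>l + k. (\<Sum>i<j. X i x) \<le> R}"
      then have "S x + Y x \<le> R" by (auto simp flip: split)
      with x show "x \<in> {x\<in>space M. (\<forall>k\<le>l. (\<Sum>i<k. X i x) \<le> R) \<and> Y x \<le> Q + R} \<union> {x\<in>space M. \<bar>S x\<bar> \<ge> Q}"
        by auto
    qed measurable
    also have "\<dots> \<le> \<P>(x in M. (\<forall>k\<le>l. (\<Sum>i<k. X i x) \<le> R) \<and> Y x \<le> Q + R) + \<P>(x in M. \<bar>S x\<bar> \<ge> Q)"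
      by (intro measure_Un_le) measurable
    finally show ?thesis using ind tail by (intro exI[of _ k]) linarith
  qed
  have dec: "decseq p"
    unfolding p_def by (intro decseq_SucI finite_measure_mono) auto
  have p0: "0 \<le> p l" for l by (simp add: p_def)
  obtain L where L: "p \<longlonglongrightarrow> L" "\<And>l. L \<le> p l"
    using decseq_convergent[OF dec, of 0] p0 by blast
  \<comment> \<open>Here \<delta> tends to 0 for fixed \<open>l\<close>; afterwards \<open>l\<close>
    tends to infinity, and \<open>L \<le> (1 - clt_gap) * L\<close> forces the limit to
    vanish.\<close>
  have "L \<le> (1 - clt_gap) * p l" for l
  proof (rule field_le_epsilon)
    fix \<delta> :: real assume "0 < \<delta>"
    from step[OF this, of l] obtain k where "p (l + k) \<le> (1 - clt_gap) * p l + \<delta>" by blast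
    with L(2)[of "l + k"] show "L \<le> (1 - clt_gap) * p l + \<delta>" by linarith
  qed
  then have "L \<le> (1 - clt_gap) * L"
    by (intro LIMSEQ_le[OF tendsto_const tendsto_mult[OF tendsto_const L(1)]]) auto
  then have "L \<le> 0" using clt_gap by (simp add: algebra_simps mult_le_0_iff)
  then have "eventually (\<lambda>l. p l < \<epsilon>) sequentially"
    using \<epsilon> by (intro order_tendstoD(2)[OF L(1)]) simp
  then show ?thesis unfolding p_def eventually_sequentially by blast
qed

end

section \<open>Last-passage times between two sites\<close>

interpretation lpp: prob_space lpp_measure
  by (rule prob_space_lpp_measure)

interpretation exp1: prob_space exp1_measure
  by (rule prob_space_exp1_measure)

section \<open>Exponential weights: law, moments and independence\<close>

lemma space_exp1_measure: "space exp1_measure = {0..}"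
  by (simp add: exp1_measure_def space_restrict_space)

lemma id_measurable_exp1: "(\<lambda>x. x) \<in> borel_measurable exp1_measure"
  unfolding exp1_measure_def by (intro measurable_restrict_space1) simp

lemma coordinate_measurable_PiM:
  assumes "z \<in> A"
  shows "(\<lambda>\<omega>. \<omega> z) \<in> borel_measurable (PiM A (\<lambda>_. exp1_measure))"
  using measurable_compose[OF measurable_component_singleton[OF assms] id_measurable_exp1] by simp

lemma coordinate_measurable [measurable]: "(\<lambda>\<omega>. \<omega> z) \<in> borel_measurable lpp_measure"
  unfolding lpp_measure_def by (rule coordinate_measurable_PiM) simp

lemma coordinate_nonneg: "\<omega> \<in> space lpp_measure \<Longrightarrow> 0 \<le> \<omega> z"
  by (cases z) (simp add: space_lpp_measure)

lemma nn_integral_exp1: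
  assumes [measurable]: "f \<in> borel_measurable borel"
  shows "(\<integral>\<^sup>+x. f x \<partial>exp1_measure)
    = (\<integral>\<^sup>+x. ennreal (exponential_density 1 x) * f x \<partial>lborel)"
proof -
  have "(\<integral>\<^sup>+x. f x \<partial>exp1_measure)
      = (\<integral>\<^sup>+x. ennreal (exponential_density 1 x) * (f x * indicator {0..} x) \<partial>lborel)"
    unfolding exp1_measure_def
    by (subst nn_integral_restrict_space) (auto simp: nn_integral_density)
  also have "\<dots> = (\<integral>\<^sup>+x. ennreal (exponential_density 1 x) * f x \<partial>lborel)"
    by (intro nn_integral_cong) (auto simp: exponential_density_def split: split_indicator)
  finally show ?thesis .
qed

lemma distr_lpp_coordinate: "distr lpp_measure exp1_measure (\<lambda>\<omega>. \<omega> z) = exp1_measure"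
  unfolding lpp_measure_def
  by (rule distr_PiM_component) (auto intro: prob_space_exp1_measure)

lemma coordinate_measurable_exp1: "(\<lambda>\<omega>. \<omega> z) \<in> measurable lpp_measure exp1_measure"
  unfolding lpp_measure_def by (rule measurable_component_singleton) simp

lemma nn_integral_coordinate:
  assumes [measurable]: "f \<in> borel_measurable borel"
  shows "(\<integral>\<^sup>+\<omega>. f (\<omega> z) \<partial>lpp_measure)
    = (\<integral>\<^sup>+x. ennreal (exponential_density 1 x) * f x \<partial>lborel)"
proof -
  have f: "f \<in> borel_measurable exp1_measure"
    using measurable_compose[OF id_measurable_exp1 assms] by simp
  have "(\<integral>\<^sup>+\<omega>. f (\<omega> z) \<partial>lpp_measure) = (\<integral>\<^sup>+x. f x \<partial>distr lpp_measure exp1_measure (\<lambda>\<omega>. \<omega> z))"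
    using f by (intro nn_integral_distr[symmetric] coordinate_measurable_exp1) simp
  then show ?thesis by (simp add: distr_lpp_coordinate nn_integral_exp1)
qed

text \<open>The weights live on \<open>{0..}\<close>; since the density vanishes on the negative
  axis, they are exponential variables on the whole line, which gives their moments and
  tails.\<close>

lemma distributed_coordinate:
  "distributed lpp_measure lborel (\<lambda>\<omega>. \<omega> z) (exponential_density 1)"
  unfolding distributed_def
proof (intro conjI)
  show "distr lpp_measure lborel (\<lambda>\<omega>. \<omega> z) = density lborel (exponential_density 1)"
  proof (rule measure_eqI)
    fix A assume "A \<in> sets (distr lpp_measure lborel (\<lambda>\<omega>. \<omega> z))"
    then have [measurable]: "A \<in> sets borel" by simp
    have "emeasure (distr lpp_measure lborel (\<lambda>\<omega>. \<omega> z)) A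
        = (\<integral>\<^sup>+x. indicator A x \<partial>distr lpp_measure lborel (\<lambda>\<omega>. \<omega> z))" by simp
    also have "\<dots> = (\<integral>\<^sup>+\<omega>. indicator A (\<omega> z) \<partial>lpp_measure)"
      by (rule nn_integral_distr) auto
    also have "\<dots> = emeasure (density lborel (exponential_density 1)) A"
      by (subst nn_integral_coordinate) (auto simp: emeasure_density)
    finally show "emeasure (distr lpp_measure lborel (\<lambda>\<omega>. \<omega> z)) A
      = emeasure (density lborel (exponential_density 1)) A" .
  qed simp
qed auto

lemma integrable_coordinate: "integrable lpp_measure (\<lambda>\<omega>. \<omega> z)"
  and expectation_coordinate: "lpp.expectation (\<lambda>\<omega>. \<omega> z) = 1"
  and integrable_coordinate_square: "integrable lpp_measure (\<lambda>\<omega>. (\<omega> z)\<^sup>2)"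
  and variance_coordinate: "lpp.variance (\<lambda>\<omega>. \<omega> z) = 1"
  using lpp.erlang_ith_moment_integrable[OF zero_less_one distributed_coordinate[of z], of 1]
    lpp.erlang_ith_moment_integrable[OF zero_less_one distributed_coordinate[of z], of 2]
    lpp.exponential_distributed_expectation[OF _ distributed_coordinate, of z]
    lpp.exponential_distributed_variance[OF _ distributed_coordinate, of z] by simp_all

lemma indep_vars_coordinates:
  "lpp.indep_vars (\<lambda>_. exp1_measure) (\<lambda>z \<omega>. \<omega> z) UNIV"
  by (subst lpp.indep_vars_iff_distr_eq_PiM)
     (auto simp: coordinate_measurable_exp1 distr_lpp_coordinate lpp_measure_def[symmetric]
       restrict_UNIV)

lemma indep_var_restrict:
  assumes "A \<inter> B = {}"
  shows "lpp.indep_var (PiM A (\<lambda>_. exp1_measure)) (\<lambda>\<omega>. restrict \<omega> A)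
    (PiM B (\<lambda>_. exp1_measure)) (\<lambda>\<omega>. restrict \<omega> B)"
  using lpp.indep_var_restrict[OF indep_vars_coordinates assms] by simp

text \<open>The invariance under restriction says that \<open>f\<close> and \<open>g\<close> depend
  only on the weights in \<open>A\<close> and \<open>B\<close>, so both factor through independent
  restrictions.\<close>

lemma indep_var_disjoint_sites:
  assumes "A \<inter> B = {}"
    and "f \<in> measurable (PiM A (\<lambda>_. exp1_measure)) N1" "g \<in> measurable (PiM B (\<lambda>_. exp1_measure)) N2"
    and "\<And>\<omega>. f (restrict \<omega> A) = f \<omega>" "\<And>\<omega>. g (restrict \<omega> B) = g \<omega>"
  shows "lpp.indep_var N1 f N2 g"
  using lpp.indep_var_compose[OF indep_var_restrict[OF assms(1)] assms(2,3)] assms(4,5)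
  by (simp add: comp_def)

text \<open>Exponential tilting: \<open>exp (t * x)\<close> times the density of parameter 1 is
  \<open>1 / (1 - t)\<close> times the density of parameter \<open>1 - t\<close>.\<close>

lemma nn_integral_exp_coordinate:
  assumes "0 \<le> t" "t < 1"
  shows "(\<integral>\<^sup>+\<omega>. ennreal (exp (t * \<omega> z)) \<partial>lpp_measure) = ennreal (1 / (1 - t))"
proof -
  interpret D: prob_space "density lborel (exponential_density (1 - t))"
    using assms by (intro prob_space_exponential_density) simp
  have "(\<integral>\<^sup>+x. ennreal (exponential_density 1 x) * ennreal (exp (t * x)) \<partial>lborel)
      = (\<integral>\<^sup>+x. ennreal (1 / (1 - t)) * ennreal (exponential_density (1 - t) x) \<partial>lborel)"
  proof (intro nn_integral_cong)
    fix x :: real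
    have "exp (- x) * exp (t * x) = 1 / (1 - t) * ((1 - t) * exp (- x * (1 - t)))"
      using assms by (simp add: exp_add[symmetric]) (simp add: algebra_simps)
    then show "ennreal (exponential_density 1 x) * ennreal (exp (t * x))
        = ennreal (1 / (1 - t)) * ennreal (exponential_density (1 - t) x)"
      using assms by (simp add: exponential_density_def ennreal_mult[symmetric])
  qed
  also have "\<dots> = ennreal (1 / (1 - t)) * emeasure (density lborel (exponential_density (1 - t))) (space lborel)"
    by (subst nn_integral_cmult) (auto simp: emeasure_density)
  also have "\<dots> = ennreal (1 / (1 - t))"
    using D.emeasure_space_1 by simp
  finally show ?thesis by (subst nn_integral_coordinate) auto
qed

text \<open>\<open>lp \<omega> x y k l\<close> is the last-passage time from \<open>(x, y)\<close> to \<open>(x + k, y + l)\<close>.\<close>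

fun lp :: "(site \<Rightarrow> real) \<Rightarrow> nat \<Rightarrow> nat \<Rightarrow> nat \<Rightarrow> nat \<Rightarrow> real" where
  "lp \<omega> x y 0 0 = \<omega> (x, y)"
| "lp \<omega> x y (Suc k) 0 = \<omega> (x, y) + lp \<omega> (Suc x) y k 0"
| "lp \<omega> x y 0 (Suc l) = \<omega> (x, y) + lp \<omega> x (Suc y) 0 l"
| "lp \<omega> x y (Suc k) (Suc l) =
     \<omega> (x, y) + max (lp \<omega> (Suc x) y k (Suc l)) (lp \<omega> x (Suc y) (Suc k) l)"

lemma lp_measurable_PiM:
  assumes "{x..x + k} \<times> {y..y + l} \<subseteq> A"
  shows "(\<lambda>\<omega>. lp \<omega> x y k l) \<in> borel_measurable (PiM A (\<lambda>_. exp1_measure))"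
  using assms
proof (induction "\<lambda>_::site. 0::real" x y k l rule: lp.induct)
  case (4 x y k l)
  have "(\<lambda>\<omega>. lp \<omega> (Suc x) y k (Suc l)) \<in> borel_measurable (PiM A (\<lambda>_. exp1_measure))"
    "(\<lambda>\<omega>. lp \<omega> x (Suc y) (Suc k) l) \<in> borel_measurable (PiM A (\<lambda>_. exp1_measure))"
    "(\<lambda>\<omega>. \<omega> (x, y)) \<in> borel_measurable (PiM A (\<lambda>_. exp1_measure))"
    using 4 by (auto intro!: 4 coordinate_measurable_PiM)
  then show ?case by simp
next
  case (1 x y) then show ?case by (auto intro!: coordinate_measurable_PiM)
next
  case (2 x y k)
  have "(\<lambda>\<omega>. lp \<omega> (Suc x) y k 0) \<in> borel_measurable (PiM A (\<lambda>_. exp1_measure))"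
    "(\<lambda>\<omega>. \<omega> (x, y)) \<in> borel_measurable (PiM A (\<lambda>_. exp1_measure))"
    using 2(2) by (auto intro!: 2(1) coordinate_measurable_PiM)
  then show ?case by simp
next
  case (3 x y l)
  have "(\<lambda>\<omega>. lp \<omega> x (Suc y) 0 l) \<in> borel_measurable (PiM A (\<lambda>_. exp1_measure))"
    "(\<lambda>\<omega>. \<omega> (x, y)) \<in> borel_measurable (PiM A (\<lambda>_. exp1_measure))"
    using 3(2) by (auto intro!: 3(1) coordinate_measurable_PiM)
  then show ?case by simp
qed

lemma lp_measurable [measurable]: "(\<lambda>\<omega>. lp \<omega> x y k l) \<in> borel_measurable lpp_measure"
  unfolding lpp_measure_def by (rule lp_measurable_PiM) simp

lemma lp_cong:
  assumes "\<And>z. z \<in> {x..x + k} \<times> {y..y + l} \<Longrightarrow> \<omega> z = \<omega>' z"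
  shows "lp \<omega> x y k l = lp \<omega>' x y k l"
  using assms by (induction \<omega> x y k l rule: lp.induct) auto

lemma lp_shift: "lp \<omega> (a + x) (b + y) k l = lp (\<lambda>(i, j). \<omega> (a + i, b + j)) x y k l"
proof (induction \<omega> x y k l rule: lp.induct)
  case (4 \<omega> x y k l) then show ?case using 4 by simp
qed simp_all

lemma integrable_lp: "integrable lpp_measure (\<lambda>\<omega>. lp \<omega> x y k l)"
  by (induction "\<lambda>_::site. 0::real" x y k l rule: lp.induct)
     (auto intro!: integrable_coordinate Bochner_Integration.integrable_add integrable_max)

lemma lp_Suc_ge_right: "\<omega> (x, y) + lp \<omega> (Suc x) y k l \<le> lp \<omega> x y (Suc k) l"
  by (cases l) auto

lemma lp_Suc_ge_up: "\<omega> (x, y) + lp \<omega> x (Suc y) k l \<le> lp \<omega> x y k (Suc l)"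
  by (cases k) auto

lemma lp_nonneg: "(\<And>z. 0 \<le> \<omega> z) \<Longrightarrow> 0 \<le> lp \<omega> x y k l"
  by (induction \<omega> x y k l rule: lp.induct) (auto simp: add_nonneg_nonneg max_def)

section \<open>Stationarity and the mean last-passage time\<close>

definition mean_lp :: "nat \<Rightarrow> nat \<Rightarrow> real" where
  "mean_lp k l = lpp.expectation (\<lambda>\<omega>. lp \<omega> 0 0 k l)"

lemma shift_measurable [measurable]:
  "(\<lambda>\<omega>. \<lambda>(i, j). \<omega> (a + i, b + j)) \<in> measurable lpp_measure lpp_measure"
proof -
  have "(\<lambda>\<omega>. \<lambda>n\<in>UNIV. \<omega> (case n of (i, j) \<Rightarrow> (a + i, b + j))) \<in> measurable lpp_measure lpp_measure"
    unfolding lpp_measure_def by (rule measurable_restrict) (simp add: measurable_component_singleton)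
  then show ?thesis by (simp add: restrict_UNIV prod.case_distrib[of "\<lambda>x. _ x"] case_prod_beta')
qed

text \<open>A translation reindexes the i.i.d. family injectively. Hence means depend only on the
  displacement between the endpoints, and the steps of the two-row walk have a common law.\<close>

lemma distr_shift:
  "distr lpp_measure lpp_measure (\<lambda>\<omega>. \<lambda>(i, j). \<omega> (a + i, b + j)) = lpp_measure"
  unfolding lpp_measure_def
  using distr_PiM_reindex[of UNIV "\<lambda>_. exp1_measure" "\<lambda>(i, j). (a + i, b + j)" "UNIV::site set"]
  by (simp add: inj_on_def prob_space_exp1_measure restrict_UNIV case_prod_beta')

lemma expectation_lp: "lpp.expectation (\<lambda>\<omega>. lp \<omega> x y k l) = mean_lp k l"
proof -
  have "mean_lp k l = (\<integral>\<omega>. lp \<omega> 0 0 k l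
      \<partial>distr lpp_measure lpp_measure (\<lambda>\<omega>. \<lambda>(i, j). \<omega> (x + i, y + j)))"
    by (simp add: distr_shift mean_lp_def)
  also have "\<dots> = lpp.expectation (\<lambda>\<omega>. lp (\<lambda>(i, j). \<omega> (x + i, y + j)) 0 0 k l)"
    by (rule integral_distr[OF shift_measurable]) measurable
  also have "\<dots> = lpp.expectation (\<lambda>\<omega>. lp \<omega> x y k l)"
    using lp_shift[of _ x 0 y 0 k l] by simp
  finally show ?thesis by simp
qed

section \<open>Bounds on the mean last-passage time\<close>

lemma nn_integral_coordinate_mult_exp_lp:
  assumes "(x, y) \<notin> {x'..x' + k} \<times> {y'..y' + l}"
  shows "(\<integral>\<^sup>+\<omega>. ennreal (exp (t * \<omega> (x, y))) * ennreal (exp (t * lp \<omega> x' y' k l)) \<partial>lpp_measure)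
    = (\<integral>\<^sup>+\<omega>. ennreal (exp (t * \<omega> (x, y))) \<partial>lpp_measure)
      * (\<integral>\<^sup>+\<omega>. ennreal (exp (t * lp \<omega> x' y' k l)) \<partial>lpp_measure)"
proof -
  let ?B = "{x'..x' + k} \<times> {y'..y' + l}"
  have c: "(\<lambda>\<omega>. \<omega> (x, y)) \<in> borel_measurable (PiM {(x, y)} (\<lambda>_. exp1_measure))"
    by (rule coordinate_measurable_PiM) simp
  have "(\<lambda>\<omega>. lp \<omega> x' y' k l) \<in> borel_measurable (PiM ?B (\<lambda>_. exp1_measure))"
    by (rule lp_measurable_PiM) simp
  moreover have "lp (restrict \<omega> ?B) x' y' k l = lp \<omega> x' y' k l" for \<omega>
    by (rule lp_cong) simp
  ultimately have "lpp.indep_var borel (\<lambda>\<omega>. ennreal (exp (t * \<omega> (x, y))))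
      borel (\<lambda>\<omega>. ennreal (exp (t * lp \<omega> x' y' k l)))"
    using assms c by (intro indep_var_disjoint_sites[where A="{(x, y)}" and B="?B"]) simp_all
  then have "lpp.indep_vars (\<lambda>_. borel) (case_bool (\<lambda>\<omega>. ennreal (exp (t * \<omega> (x, y))))
      (\<lambda>\<omega>. ennreal (exp (t * lp \<omega> x' y' k l)))) UNIV"
    unfolding lpp.indep_var_def by (rule back_subst[of "\<lambda>M. lpp.indep_vars M _ _"])
      (auto simp: fun_eq_iff split: bool.split)
  from lpp.indep_vars_nn_integral[OF _ this] show ?thesis
    by (simp add: UNIV_bool mult.commute)
qed

text \<open>The bound solves the recursion \<open>b (k+1) (l+1) = c (b k (l+1) + b (k+1) l)\<close>, which arises from
  bounding the exponential of a maximum by a sum of exponentials.\<close>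

lemma nn_integral_exp_lp_le:
  fixes t r :: real
  assumes t: "0 \<le> t" "t < 1" and r: "0 < r" "r \<le> 1"
  defines "c \<equiv> 1 / (1 - t)"
  shows "(\<integral>\<^sup>+\<omega>. ennreal (exp (t * lp \<omega> x y k l)) \<partial>lpp_measure)
    \<le> ennreal (c * (c * (1 + r)) ^ k * (c * ((1 + r) / r)) ^ l)"
proof (induction "\<lambda>_::site. 0::real" x y k l rule: lp.induct)
  have c1: "1 \<le> c" using t by (simp add: c_def)
  \<comment> \<open>\<open>ca\<close> and \<open>cb\<close> treat the two boundary directions, where
    a path has only one possible step and the recursion loses nothing but a factor
    \<open>c\<close>.\<close>
  have ca: "c \<le> c * (1 + r)" using c1 r by simp
  have cb: "c \<le> c * ((1 + r) / r)" using c1 r by (simp add: field_simps)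
  have c: "(\<integral>\<^sup>+\<omega>. ennreal (exp (t * \<omega> z)) \<partial>lpp_measure) = ennreal c" for z
    unfolding c_def using t by (rule nn_integral_exp_coordinate)
  have pos: "0 \<le> c" "0 \<le> c * (1 + r)" "0 \<le> c * ((1 + r) / r)" using c1 r by simp_all
  {
    case (1 x y) then show ?case by (simp add: c)
  next
    case (2 x y k)
    have "(\<integral>\<^sup>+\<omega>. ennreal (exp (t * lp \<omega> x y (Suc k) 0)) \<partial>lpp_measure)
        = ennreal c * (\<integral>\<^sup>+\<omega>. ennreal (exp (t * lp \<omega> (Suc x) y k 0)) \<partial>lpp_measure)"
      by (simp add: ring_distribs exp_add ennreal_mult nn_integral_coordinate_mult_exp_lp c)
    also have "\<dots> \<le> ennreal c * ennreal (c * (c * (1 + r)) ^ k * (c * ((1 + r) / r)) ^ 0)"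
      by (intro mult_left_mono 2) simp
    also have "\<dots> = ennreal (c * (c * (c * (1 + r)) ^ k))"
      using pos by (simp add: ennreal_mult[symmetric])
    also have "\<dots> \<le> ennreal (c * ((c * (1 + r)) * (c * (1 + r)) ^ k))"
      using pos ca by (intro ennreal_leI mult_left_mono mult_right_mono zero_le_power)
    also have "\<dots> = ennreal (c * (c * (1 + r)) ^ Suc k * (c * ((1 + r) / r)) ^ 0)" by simp
    finally show ?case .
  next
    case (3 x y l)
    have "(\<integral>\<^sup>+\<omega>. ennreal (exp (t * lp \<omega> x y 0 (Suc l))) \<partial>lpp_measure)
        = ennreal c * (\<integral>\<^sup>+\<omega>. ennreal (exp (t * lp \<omega> x (Suc y) 0 l)) \<partial>lpp_measure)"
      by (simp add: ring_distribs exp_add ennreal_mult nn_integral_coordinate_mult_exp_lp c)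
    also have "\<dots> \<le> ennreal c * ennreal (c * (c * (1 + r)) ^ 0 * (c * ((1 + r) / r)) ^ l)"
      by (intro mult_left_mono 3) simp
    also have "\<dots> = ennreal (c * (c * (c * ((1 + r) / r)) ^ l))"
      using pos by (simp add: ennreal_mult[symmetric])
    also have "\<dots> \<le> ennreal (c * ((c * ((1 + r) / r)) * (c * ((1 + r) / r)) ^ l))"
      using pos cb by (intro ennreal_leI mult_left_mono mult_right_mono zero_le_power)
    also have "\<dots> = ennreal (c * (c * (1 + r)) ^ 0 * (c * ((1 + r) / r)) ^ Suc l)" by simp
    finally show ?case .
  next
    case (4 x y k l)
    define a b where "a = c * (1 + r)" and "b = c * ((1 + r) / r)"
    \<comment> \<open>The last identity says \<open>1 / a + 1 / b = 1 / c\<close>, which closes the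
      recursion; \<open>r\<close> parametrises its solutions. Small \<open>r\<close> brings
      \<open>a\<close> close to \<open>c\<close> at the price of a large \<open>b\<close>.\<close>
    have ab: "0 \<le> a" "0 \<le> b" "c * a + c * b = a * b"
      using pos r by (simp_all add: a_def b_def field_simps)
    have "ennreal (exp (t * lp \<omega> x y (Suc k) (Suc l)))
        \<le> ennreal (exp (t * \<omega> (x, y))) * ennreal (exp (t * lp \<omega> (Suc x) y k (Suc l)))
          + ennreal (exp (t * \<omega> (x, y))) * ennreal (exp (t * lp \<omega> x (Suc y) (Suc k) l))" for \<omega>
      using t by (auto simp: ennreal_mult[symmetric] ennreal_plus[symmetric] exp_add[symmetric]
          ring_distribs max_def simp del: ennreal_plus intro!: ennreal_leI)
    then have "(\<integral>\<^sup>+\<omega>. ennreal (exp (t * lp \<omega> x y (Suc k) (Suc l))) \<partial>lpp_measure)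
        \<le> (\<integral>\<^sup>+\<omega>. ennreal (exp (t * \<omega> (x, y))) * ennreal (exp (t * lp \<omega> (Suc x) y k (Suc l)))
          + ennreal (exp (t * \<omega> (x, y))) * ennreal (exp (t * lp \<omega> x (Suc y) (Suc k) l)) \<partial>lpp_measure)"
      by (rule nn_integral_mono)
    also have "\<dots> = ennreal c * (\<integral>\<^sup>+\<omega>. ennreal (exp (t * lp \<omega> (Suc x) y k (Suc l))) \<partial>lpp_measure)
        + ennreal c * (\<integral>\<^sup>+\<omega>. ennreal (exp (t * lp \<omega> x (Suc y) (Suc k) l)) \<partial>lpp_measure)"
      by (subst nn_integral_add, measurable)
        (subst nn_integral_coordinate_mult_exp_lp, simp,
         subst nn_integral_coordinate_mult_exp_lp, simp, simp add: c)
    also have "\<dots> \<le> ennreal c * ennreal (c * a ^ k * b ^ Suc l)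
        + ennreal c * ennreal (c * a ^ Suc k * b ^ l)"
      using 4 by (intro add_mono mult_left_mono) (auto simp: a_def b_def)
    also have "\<dots> = ennreal (c * a ^ k * b ^ l * (c * b + c * a))"
      using ab(1,2) pos by (simp add: ennreal_mult[symmetric] ennreal_plus[symmetric] algebra_simps
          del: ennreal_plus)
    also have "c * b + c * a = a * b" using ab(3) by simp
    also have "c * a ^ k * b ^ l * (a * b) = c * a ^ Suc k * b ^ Suc l"
      by simp
    finally show ?case unfolding a_def b_def .
  }
qed

text \<open>Jensen's inequality: \<open>t\<close> times the mean is at most the logarithm of the
  exponential moment, and the logarithm turns the product bound into one linear in \<open>k\<close>
  and \<open>l\<close>.\<close>

lemma mean_lp_le:
  fixes t r :: real
  assumes t: "0 < t" "t < 1" and r: "0 < r" "r \<le> 1"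
  defines "c \<equiv> 1 / (1 - t)"
  shows "t * mean_lp k l \<le> ln c + k * (ln c + ln (1 + r)) + l * ln (c * ((1 + r) / r))"
proof -
  define \<Phi> where "\<Phi> = c * (c * (1 + r)) ^ k * (c * ((1 + r) / r)) ^ l"
  have c: "0 < c" using t by (simp add: c_def)
  have \<Phi>: "0 < \<Phi>" unfolding \<Phi>_def using c r by (intro mult_pos_pos zero_less_power) auto
  have b: "(\<integral>\<^sup>+\<omega>. ennreal (exp (t * lp \<omega> 0 0 k l)) \<partial>lpp_measure) \<le> ennreal \<Phi>"
    unfolding \<Phi>_def c_def using assms by (intro nn_integral_exp_lp_le) auto
  have i: "integrable lpp_measure (\<lambda>\<omega>. exp (t * lp \<omega> 0 0 k l))"
    using b by (intro integrableI_nonneg) (auto simp: top.not_eq_extremum intro: le_less_trans)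
  have e: "lpp.expectation (\<lambda>\<omega>. exp (t * lp \<omega> 0 0 k l)) \<le> \<Phi>"
    using b i \<Phi> by (subst (asm) nn_integral_eq_integral) (auto simp: ennreal_le_iff)
  \<comment> \<open>The tangent of the exponential at \<open>ln \<Phi>\<close>; integrating it
    replaces an appeal to convexity.\<close>
  have "t * lp \<omega> 0 0 k l \<le> ln \<Phi> - 1 + exp (t * lp \<omega> 0 0 k l) / \<Phi>" for \<omega>
    using exp_ge_add_one_self[of "t * lp \<omega> 0 0 k l - ln \<Phi>"] \<Phi> by (simp add: exp_diff)
  then have "lpp.expectation (\<lambda>\<omega>. t * lp \<omega> 0 0 k l)
      \<le> lpp.expectation (\<lambda>\<omega>. ln \<Phi> - 1 + exp (t * lp \<omega> 0 0 k l) / \<Phi>)"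
    using i by (intro integral_mono) (auto intro!: integrable_lp)
  also have "\<dots> = ln \<Phi> - 1 + lpp.expectation (\<lambda>\<omega>. exp (t * lp \<omega> 0 0 k l)) / \<Phi>"
    using i by (simp add: lpp.prob_space)
  also have "\<dots> \<le> ln \<Phi>" using e \<Phi> by simp
  also have "ln \<Phi> = ln c + k * (ln c + ln (1 + r)) + l * ln (c * ((1 + r) / r))"
    unfolding \<Phi>_def using c r by (simp add: ln_mult_pos ln_realpow)
  finally show ?thesis by (simp add: mean_lp_def)
qed

text \<open>With \<open>r = t\<^sup>2\<close> and small \<open>t\<close>, a horizontal step costs
  \<open>(ln c + ln (1 + r)) / t \<le> 1 + 3 * t\<close>, close to the mean weight. The cost of a
  vertical step is finite but may be very large.\<close>

lemma mean_lp_nearly_horizontal: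
  fixes \<eta> :: real
  assumes "0 < \<eta>"
  obtains C :: real where "0 \<le> C" "\<And>k l. mean_lp k l \<le> (1 + \<eta>) * k + C * l + C"
proof -
  define t where "t = min (\<eta> / 3) (1 / 2)"
  define c where "c = 1 / (1 - t)"
  define C where "C = (ln c + ln (c * ((1 + t\<^sup>2) / t\<^sup>2))) / t"
  have t: "0 < t" "t \<le> 1/2" "3 * t \<le> \<eta>" using assms by (auto simp: t_def)
  have t2: "0 < t\<^sup>2" "t\<^sup>2 \<le> 1" using t by (auto simp: power_le_one)
  have c: "1 \<le> c" using t by (simp add: c_def)
  have lc: "0 \<le> ln c" using c by simp
  have b1: "1 \<le> (1 + t\<^sup>2) / t\<^sup>2" using t2 by (simp add: field_simps)
  have "1 * 1 \<le> c * ((1 + t\<^sup>2) / t\<^sup>2)" using c b1 by (intro mult_mono) auto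
  then have lb: "0 \<le> ln (c * ((1 + t\<^sup>2) / t\<^sup>2))" by simp
  have "ln c \<le> c - 1" using c by (intro ln_le_minus_one) simp
  also have "c - 1 = t * c" using t by (simp add: c_def field_simps)
  also have "c \<le> 1 + 2 * t" using t mult_mono[of t "1/2" t t] by (simp add: c_def field_simps)
  finally have l1: "ln c \<le> t * (1 + 2 * t)" using t by simp
  have "ln (1 + t\<^sup>2) \<le> t\<^sup>2" using t2 by (intro ln_add_one_self_le_self) simp
  with l1 have "ln c + ln (1 + t\<^sup>2) \<le> t * (1 + 3 * t)" by (simp add: power2_eq_square algebra_simps)
  also have "\<dots> \<le> t * (1 + \<eta>)" using t by (intro mult_left_mono) auto
  finally have a: "ln c + ln (1 + t\<^sup>2) \<le> t * (1 + \<eta>)" .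
  have tC: "t * C = ln c + ln (c * ((1 + t\<^sup>2) / t\<^sup>2))" using t by (simp add: C_def)
  have "mean_lp k l \<le> (1 + \<eta>) * k + C * l + C" for k l
  proof -
    have "t * mean_lp k l \<le> ln c + k * (ln c + ln (1 + t\<^sup>2)) + l * ln (c * ((1 + t\<^sup>2) / t\<^sup>2))"
      unfolding c_def using t t2 by (intro mean_lp_le) auto
    also have "\<dots> \<le> t * C + k * (t * (1 + \<eta>)) + l * (t * C)"
      unfolding tC using lc lb by (intro add_mono mult_left_mono a) auto
    also have "\<dots> = t * ((1 + \<eta>) * k + C * l + C)" by (simp add: algebra_simps)
    finally show ?thesis using t by simp
  qed
  moreover have "0 \<le> C" using lc lb t by (simp add: C_def)
  ultimately show ?thesis using that by blast
qed

lemma mean_lp_increment_right: "mean_lp k l + 1 \<le> mean_lp (Suc k) l"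
proof -
  have "lpp.expectation (\<lambda>\<omega>. \<omega> (0, 0) + lp \<omega> (Suc 0) 0 k l) \<le> lpp.expectation (\<lambda>\<omega>. lp \<omega> 0 0 (Suc k) l)"
    by (intro integral_mono lp_Suc_ge_right Bochner_Integration.integrable_add
        integrable_lp integrable_coordinate)
  then show ?thesis
    by (simp add: integrable_coordinate integrable_lp expectation_lp expectation_coordinate)
qed

lemma mean_lp_increment_up: "mean_lp k l + 1 \<le> mean_lp k (Suc l)"
proof -
  have "lpp.expectation (\<lambda>\<omega>. \<omega> (0, 0) + lp \<omega> 0 (Suc 0) k l) \<le> lpp.expectation (\<lambda>\<omega>. lp \<omega> 0 0 k (Suc l))"
    by (intro integral_mono lp_Suc_ge_up Bochner_Integration.integrable_add
        integrable_lp integrable_coordinate)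
  then show ?thesis
    by (simp add: integrable_coordinate integrable_lp expectation_lp expectation_coordinate)
qed

lemma mean_lp_nonneg: "0 \<le> mean_lp k l"
  unfolding mean_lp_def
  by (rule Bochner_Integration.integral_nonneg_AE)
    (auto intro!: AE_I2 lp_nonneg simp: space_lpp_measure)

text \<open>Each of the \<open>w\<close> offsets contributes a shifted sum contained in the full
  one, so no term is counted more than \<open>w\<close> times.\<close>

lemma sum_window_le:
  fixes h :: "nat \<Rightarrow> real"
  assumes "\<And>k. 0 \<le> h k"
  shows "(\<Sum>x<p. \<Sum>i<w. h (x + i)) \<le> w * (\<Sum>k<p + w. h k)"
proof -
  have "(\<Sum>x<p. h (x + i)) \<le> (\<Sum>k<p + w. h k)" if "i < w" for i
  proof -
    have "(\<Sum>x<p. h (x + i)) = sum h ((\<lambda>x. x + i) ` {..<p})"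
      by (subst sum.reindex) (auto simp: inj_on_def)
    also have "\<dots> \<le> (\<Sum>k<p + w. h k)"
      using that assms by (intro sum_mono2) auto
    finally show ?thesis .
  qed
  then have "(\<Sum>i<w. \<Sum>x<p. h (x + i)) \<le> (\<Sum>i<w. \<Sum>k<p + w. h k)"
    by (intro sum_mono) auto
  then show ?thesis by (subst sum.swap) simp
qed

lemma sum_window2_le:
  fixes h :: "nat \<Rightarrow> nat \<Rightarrow> real"
  assumes "\<And>k l. 0 \<le> h k l"
  shows "(\<Sum>x<p. \<Sum>y<q. \<Sum>i<w. \<Sum>j<w. h (x + i) (y + j))
    \<le> w\<^sup>2 * (\<Sum>k<p + w. \<Sum>l<q + w. h k l)"
proof -
  have "(\<Sum>x<p. \<Sum>y<q. \<Sum>i<w. \<Sum>j<w. h (x + i) (y + j))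
      = (\<Sum>x<p. \<Sum>i<w. \<Sum>y<q. \<Sum>j<w. h (x + i) (y + j))"
    by (intro sum.cong refl sum.swap)
  also have "\<dots> \<le> (\<Sum>x<p. \<Sum>i<w. w * (\<Sum>l<q + w. h (x + i) l))"
    by (intro sum_mono sum_window_le assms)
  also have "\<dots> \<le> w * (\<Sum>k<p + w. w * (\<Sum>l<q + w. h k l))"
    by (intro sum_window_le mult_nonneg_nonneg sum_nonneg assms) simp
  finally show ?thesis by (simp add: sum_distrib_left power2_eq_square mult.assoc)
qed

text \<open>In a box of size \<open>p \<times> q\<close> with \<open>p\<close> a large multiple of \<open>q\<close>, the sums of the increments
  telescope, so that the bound \<open>(1 + \<eta>') k + C' l + C'\<close> on the mean leaves too little mass for every
  window to contain a large increment.\<close>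

lemma window_with_small_increments:
  fixes \<eta> :: real and w :: nat
  assumes \<eta>: "0 < \<eta>"
  obtains C :: real where "0 < C"
    "\<And>K. \<exists>X Y. K \<le> X \<and> K \<le> Y \<and> (\<forall>i<w. \<forall>j<w.
       mean_lp (Suc (X + i)) (Y + j) - mean_lp (X + i) (Y + j) - 1 \<le> \<eta> \<and>
       mean_lp (X + i) (Suc (Y + j)) - mean_lp (X + i) (Y + j) \<le> C)"
proof -
  \<comment> \<open>The mean weight 1 is subtracted so that row sums of \<alpha> grow only with
    slope \<eta>' in the long direction.\<close>
  define \<alpha> where "\<alpha> k l = mean_lp (Suc k) l - mean_lp k l - 1" for k l
  define \<beta> where "\<beta> k l = mean_lp k (Suc l) - mean_lp k l" for k l
  have \<alpha>: "0 \<le> \<alpha> k l" and \<beta>: "0 \<le> \<beta> k l" for k l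
    using mean_lp_increment_right[of k l] mean_lp_increment_up[of k l] by (auto simp: \<alpha>_def \<beta>_def)
  define A where "A X Y = (\<Sum>i<w. \<Sum>j<w. \<alpha> (X + i) (Y + j))" for X Y
  define B where "B X Y = (\<Sum>i<w. \<Sum>j<w. \<beta> (X + i) (Y + j))" for X Y
  \<comment> \<open>Chosen for \<open>\<eta>'w\<close>: the part of the \<alpha>-mass proportional
    to the long side then takes at most a quarter of the available
    \<open>\<eta> * H\<^sup>2 * \<rho>\<close>.\<close>
  define \<eta>' where "\<eta>' = min 1 (\<eta> / (36 * ((real w)\<^sup>2 + 1)))"
  have \<eta>': "0 < \<eta>'" "\<eta>' \<le> 1" using \<eta> by (auto simp: \<eta>'_def intro!: divide_pos_pos add_nonneg_pos)
  have "9 * w\<^sup>2 * \<eta>' \<le> 9 * (w\<^sup>2 + 1) * (\<eta> / (36 * ((real w)\<^sup>2 + 1)))"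
    using \<eta>'(1) by (intro mult_mono) (auto simp: \<eta>'_def)
  also have "\<dots> = \<eta> / 4" by (simp add: divide_simps add_nonneg_eq_0_iff)
  finally have \<eta>'w: "9 * w\<^sup>2 * \<eta>' \<le> \<eta> / 4" .
  obtain C' :: real where C': "0 \<le> C'" "\<And>k l. mean_lp k l \<le> (1 + \<eta>') * k + C' * l + C'"
    using mean_lp_nearly_horizontal[OF \<eta>'(1)] by blast
  \<comment> \<open>The aspect ratio of the box. The terms with the uncontrolled constant
    \<open>C'\<close> only see the short side, so a long box makes them a fifth of the
    budget.\<close>
  define \<rho> where "\<rho> = nat \<lceil>60 * C' * w\<^sup>2 / \<eta>\<rceil> + 1"
  have \<rho>: "1 \<le> \<rho>" by (simp add: \<rho>_def)
  have "60 * C' * w\<^sup>2 / \<eta> \<le> \<rho>" unfolding \<rho>_def by (simp add: le_nat_iff) linarith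
  then have \<rho>': "12 * C' * w\<^sup>2 \<le> \<eta> * \<rho> / 5" using \<eta> by (simp add: field_simps)
  \<comment> \<open>Twice the factor of \<open>H\<^sup>2 * \<rho>\<close> in the \<beta>-mass, so
    that the \<beta>-mass divided by \<open>C\<close> is at most half of the box; adding 1 keeps
    \<open>C\<close> positive.\<close>
  define C where "C = 2 * w\<^sup>2 * (18 * \<rho> + 12 * C') + 1"
  have C: "0 < C" using C'(1) by (simp add: C_def add_nonneg_pos)
  \<comment> \<open>The increments telescope along rows here and along columns in
    \<open>sumB\<close>; the linear bound is applied at the far end and nonnegativity at the near
    end.\<close>
  have sumA: "(\<Sum>x<p. \<Sum>y<q. A x y) \<le> w\<^sup>2 * ((q + w) * (\<eta>' * (p + w) + C' * (q + w) + C'))" for p q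
  proof -
    have "(\<Sum>k<p + w. \<alpha> k l) \<le> \<eta>' * (p + w) + C' * (q + w) + C'" if "l < q + w" for l
    proof -
      have "(\<Sum>k<p + w. \<alpha> k l) = mean_lp (p + w) l - mean_lp 0 l - (p + w)"
        using sum_lessThan_telescope[of "\<lambda>k. mean_lp k l" "p + w"]
        by (simp add: \<alpha>_def sum_subtractf)
      also have "\<dots> \<le> \<eta>' * (p + w) + C' * l + C'"
        using C'(2)[of "p + w" l] mean_lp_nonneg[of 0 l] by (simp add: algebra_simps)
      also have "\<dots> \<le> \<eta>' * (p + w) + C' * (q + w) + C'"
        using that C'(1) mult_left_mono[of "real l" "real (q + w)" C'] by simp
      finally show ?thesis .
    qed
    then have "(\<Sum>l<q + w. \<Sum>k<p + w. \<alpha> k l) \<le> (\<Sum>l<q + w. \<eta>' * (p + w) + C' * (q + w) + C')"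
      by (intro sum_mono) auto
    then have "(\<Sum>k<p + w. \<Sum>l<q + w. \<alpha> k l) \<le> (q + w) * (\<eta>' * (p + w) + C' * (q + w) + C')"
      by (subst sum.swap) simp
    then have "w\<^sup>2 * (\<Sum>k<p + w. \<Sum>l<q + w. \<alpha> k l)
        \<le> w\<^sup>2 * ((q + w) * (\<eta>' * (p + w) + C' * (q + w) + C'))"
      by (intro mult_left_mono) auto
    with sum_window2_le[where h=\<alpha> and p=p and q=q and w=w, OF \<alpha>] show ?thesis unfolding A_def of_nat_power by linarith
  qed
  have sumB: "(\<Sum>x<p. \<Sum>y<q. B x y) \<le> w\<^sup>2 * ((p + w) * (2 * (p + w) + C' * (q + w) + C'))" for p q
  proof -
    have "(\<Sum>l<q + w. \<beta> k l) \<le> 2 * (p + w) + C' * (q + w) + C'" if "k < p + w" for k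
    proof -
      have "(\<Sum>l<q + w. \<beta> k l) = mean_lp k (q + w) - mean_lp k 0"
        using sum_lessThan_telescope[of "mean_lp k" "q + w"]
        by (simp add: \<beta>_def sum_subtractf)
      also have "\<dots> \<le> (1 + \<eta>') * k + C' * (q + w) + C'"
        using C'(2)[of k "q + w"] mean_lp_nonneg[of k 0] by simp
      also have "\<dots> \<le> 2 * (p + w) + C' * (q + w) + C'"
        using that \<eta>' mult_mono[of "1 + \<eta>'" 2 "real k" "real (p + w)"] by simp
      finally show ?thesis .
    qed
    then have "(\<Sum>k<p + w. \<Sum>l<q + w. \<beta> k l) \<le> (\<Sum>k<p + w. 2 * (p + w) + C' * (q + w) + C')"
      by (intro sum_mono) auto
    then have "(\<Sum>k<p + w. \<Sum>l<q + w. \<beta> k l) \<le> (p + w) * (2 * (p + w) + C' * (q + w) + C')"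
      by simp
    then have "w\<^sup>2 * (\<Sum>k<p + w. \<Sum>l<q + w. \<beta> k l)
        \<le> w\<^sup>2 * ((p + w) * (2 * (p + w) + C' * (q + w) + C'))"
      by (intro mult_left_mono) auto
    with sum_window2_le[where h=\<beta> and p=p and q=q and w=w, OF \<beta>] show ?thesis unfolding B_def of_nat_power by linarith
  qed
  have "\<exists>X Y. K \<le> X \<and> K \<le> Y \<and> A X Y \<le> \<eta> \<and> B X Y \<le> C" for K
  proof (rule ccontr)
    assume no: "\<not> ?thesis"
    \<comment> \<open>With \<open>H\<close> above \<open>K\<close> and \<open>w\<close>, the margins
      are absorbed: the enlarged box has sides at most \<open>3 * (H * \<rho>)\<close> and
      \<open>3 * H\<close>, and removing the first \<open>K\<close> rows and columns leaves at least
      \<open>H * \<rho>\<close> by \<open>H\<close>.\<close>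
    define H where "H = K + w + 1"
    define p q where "p = 2 * H * \<rho>" and "q = 2 * H"
    define s where "s X Y = A X Y / \<eta> + B X Y / C" for X Y
    have A0: "0 \<le> A X Y" and B0: "0 \<le> B X Y" for X Y
      by (auto simp: A_def B_def intro!: sum_nonneg \<alpha> \<beta>)
    have s0: "0 \<le> s X Y" for X Y using A0[of X Y] B0[of X Y] \<eta> C by (simp add: s_def)
    have s1: "1 \<le> s X Y" if "K \<le> X" "K \<le> Y" for X Y
    proof -
      from no that have "\<eta> \<le> A X Y \<or> C \<le> B X Y" by (meson linear)
      then have "1 \<le> A X Y / \<eta> \<or> 1 \<le> B X Y / C" using \<eta> C by simp
      moreover have "0 \<le> A X Y / \<eta>" "0 \<le> B X Y / C" using A0 B0 \<eta> C by simp_all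
      ultimately show ?thesis unfolding s_def by linarith
    qed
    have H: "1 \<le> H" "K \<le> H" "w \<le> H" by (auto simp: H_def)
    have Hr: "H \<le> H * \<rho>" using \<rho> by simp
    have pw: "p + w \<le> 3 * (H * \<rho>)" "q + w \<le> 3 * H" "H * \<rho> + K \<le> p" "H + K \<le> q"
      unfolding p_def q_def using H Hr by (linarith | simp)+
    \<comment> \<open>Averaging: every remaining site contributes at least 1 to the sum of
      \<open>s\<close>, but the two mass estimates bound this sum by 9/20 + 1/2 = 19/20 of
      \<open>H\<^sup>2 * \<rho>\<close>.\<close>
    have "real (H * \<rho> * H) \<le> real ((p - K) * (q - K))"
      using pw by (intro of_nat_mono mult_mono) auto
    also have "\<dots> = (\<Sum>x\<in>{K..<p}. \<Sum>y\<in>{K..<q}. 1)" by simp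
    also have "\<dots> \<le> (\<Sum>x\<in>{K..<p}. \<Sum>y\<in>{K..<q}. s x y)"
      by (intro sum_mono s1) auto
    also have "\<dots> \<le> (\<Sum>x\<in>{K..<p}. \<Sum>y<q. s x y)"
      by (intro sum_mono sum_mono2) (auto intro: s0)
    also have "\<dots> \<le> (\<Sum>x<p. \<Sum>y<q. s x y)"
      by (intro sum_mono2) (auto intro: s0 sum_nonneg)
    also have "\<dots> = (\<Sum>x<p. \<Sum>y<q. A x y) / \<eta> + (\<Sum>x<p. \<Sum>y<q. B x y) / C"
      by (simp add: s_def sum.distrib sum_divide_distrib)
    finally have le: "real (H * \<rho> * H)
      \<le> (\<Sum>x<p. \<Sum>y<q. A x y) / \<eta> + (\<Sum>x<p. \<Sum>y<q. B x y) / C" .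
    have pwr: "real p + real w \<le> 3 * (H * \<rho>)" "real q + real w \<le> 3 * H"
      using of_nat_mono[OF pw(1), where ?'a = real] of_nat_mono[OF pw(2), where ?'a = real] by simp_all
    have C'H: "C' \<le> C' * H" using C'(1) H(1) mult_left_mono[of 1 "real H" C'] by simp
    have "(\<Sum>x<p. \<Sum>y<q. A x y) \<le> w\<^sup>2 * ((q + w) * (\<eta>' * (p + w) + C' * (q + w) + C'))"
      by (rule sumA)
    also have "\<dots> \<le> w\<^sup>2 * (3 * H * (\<eta>' * (3 * (H * \<rho>)) + C' * (3 * H) + C' * H))"
      using pwr C'(1) C'H \<eta>' by (intro mult_left_mono mult_mono add_mono) auto
    also have "\<dots> = (9 * w\<^sup>2 * \<eta>') * (H\<^sup>2 * \<rho>) + (12 * C' * w\<^sup>2) * H\<^sup>2"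
      by (simp add: algebra_simps power2_eq_square)
    also have "\<dots> \<le> (\<eta> / 4) * (H\<^sup>2 * \<rho>) + (\<eta> * \<rho> / 5) * H\<^sup>2"
      using \<eta>'w \<rho>' by (intro add_mono mult_right_mono) auto
    also have "\<dots> = \<eta> * (9 / 20 * (H\<^sup>2 * \<rho>))" by (simp add: algebra_simps)
    finally have a: "(\<Sum>x<p. \<Sum>y<q. A x y) / \<eta> \<le> 9 / 20 * (H\<^sup>2 * \<rho>)"
      using \<eta> by (simp add: divide_le_eq mult.commute)
    have "(\<Sum>x<p. \<Sum>y<q. B x y) \<le> w\<^sup>2 * ((p + w) * (2 * (p + w) + C' * (q + w) + C'))"
      by (rule sumB)
    also have "\<dots> \<le> w\<^sup>2 * (3 * (H * \<rho>) * (2 * (3 * (H * \<rho>)) + C' * (3 * H) + C' * H))"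
      using pwr C'(1) C'H by (intro mult_left_mono mult_mono add_mono) auto
    also have "\<dots> = (w\<^sup>2 * (18 * \<rho> + 12 * C')) * (H\<^sup>2 * \<rho>)"
      by (simp add: algebra_simps power2_eq_square)
    also have "\<dots> \<le> (C / 2) * (H\<^sup>2 * \<rho>)"
      by (intro mult_right_mono) (auto simp: C_def)
    finally have "(\<Sum>x<p. \<Sum>y<q. B x y) / C \<le> 1 / 2 * (H\<^sup>2 * \<rho>)"
      using C by (simp add: divide_le_eq mult.commute)
    with a le have "real (H * \<rho> * H) \<le> 19 / 20 * (H\<^sup>2 * \<rho>)" by linarith
    then have "real (H * \<rho> * H) \<le> 19 / 20 * real (H * \<rho> * H)" by (simp add: power2_eq_square mult_ac)
    moreover have "0 < real (H * \<rho> * H)" using H \<rho> by simp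
    ultimately show False by (simp add: mult_ac)
  qed
  then have *: "\<exists>X Y. K \<le> X \<and> K \<le> Y \<and> A X Y \<le> \<eta> \<and> B X Y \<le> C" for K by blast
  \<comment> \<open>All increments are nonnegative, so each single one is at most the sum over its
    window.\<close>
  have le: "\<alpha> (X + i) (Y + j) \<le> A X Y" "\<beta> (X + i) (Y + j) \<le> B X Y" if "i < w" "j < w" for X Y i j
  proof -
    have "\<alpha> (X + i) (Y + j) \<le> (\<Sum>j<w. \<alpha> (X + i) (Y + j))" "\<beta> (X + i) (Y + j) \<le> (\<Sum>j<w. \<beta> (X + i) (Y + j))"
      using that by (auto intro!: member_le_sum \<alpha> \<beta>)
    moreover have "(\<Sum>j<w. \<alpha> (X + i) (Y + j)) \<le> A X Y" "(\<Sum>j<w. \<beta> (X + i) (Y + j)) \<le> B X Y"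
      unfolding A_def B_def using that
        member_le_sum[of i "{..<w}" "\<lambda>i. \<Sum>j<w. \<alpha> (X + i) (Y + j)"]
        member_le_sum[of i "{..<w}" "\<lambda>i. \<Sum>j<w. \<beta> (X + i) (Y + j)"]
      by (auto intro!: sum_nonneg \<alpha> \<beta>)
    ultimately show "\<alpha> (X + i) (Y + j) \<le> A X Y" "\<beta> (X + i) (Y + j) \<le> B X Y" by linarith+
  qed
  show ?thesis
  proof (rule that[OF C])
    fix K
    from *[of K] obtain X Y where "K \<le> X" "K \<le> Y" "A X Y \<le> \<eta>" "B X Y \<le> C" by blast
    then have "\<forall>i<w. \<forall>j<w. \<alpha> (X + i) (Y + j) \<le> \<eta> \<and> \<beta> (X + i) (Y + j) \<le> C"
      using le(1)[THEN order_trans[OF _ \<open>A X Y \<le> \<eta>\<close>]] le(2)[THEN order_trans[OF _ \<open>B X Y \<le> C\<close>]]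
      by blast
    with \<open>K \<le> X\<close> \<open>K \<le> Y\<close> show "\<exists>X Y. K \<le> X \<and> K \<le> Y \<and> (\<forall>i<w. \<forall>j<w.
       mean_lp (Suc (X + i)) (Y + j) - mean_lp (X + i) (Y + j) - 1 \<le> \<eta> \<and>
       mean_lp (X + i) (Suc (Y + j)) - mean_lp (X + i) (Y + j) \<le> C)"
      unfolding \<alpha>_def \<beta>_def by blast
  qed
qed

section \<open>Gaps between last-passage times\<close>

lemma indep_vars_disjoint_pairs:
  fixes s t :: "nat \<Rightarrow> site"
  assumes "\<And>i j. i \<noteq> j \<Longrightarrow> {s i, t i} \<inter> {s j, t j} = {}"
  shows "lpp.indep_vars (\<lambda>_. borel) (\<lambda>i \<omega>. \<omega> (s i) - \<omega> (t i)) UNIV"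
proof -
  have "lpp.indep_vars (\<lambda>j. PiM {s j, t j} (\<lambda>_. exp1_measure)) (\<lambda>j \<omega>. restrict \<omega> {s j, t j}) UNIV"
    using lpp.indep_vars_restrict[OF indep_vars_coordinates, of UNIV "\<lambda>j. {s j, t j}"] assms
    by (simp add: disjoint_family_on_def)
  moreover have "(\<lambda>v. v (s j) - v (t j)) \<in> borel_measurable (PiM {s j, t j} (\<lambda>_. exp1_measure))" for j
    by (intro borel_measurable_diff coordinate_measurable_PiM) auto
  ultimately have "lpp.indep_vars (\<lambda>_. borel)
      (\<lambda>j \<omega>. (\<lambda>v. v (s j) - v (t j)) (restrict \<omega> {s j, t j})) UNIV"
    by (rule lpp.indep_vars_compose2)
  then show ?thesis by simp
qed

lemma coordinate_difference:
  assumes "s \<noteq> t"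
  shows "lpp.expectation (\<lambda>\<omega>. \<omega> s - \<omega> t) = 0"
    and "integrable lpp_measure (\<lambda>\<omega>. (\<omega> s - \<omega> t)\<^sup>2)"
    and "lpp.variance (\<lambda>\<omega>. \<omega> s - \<omega> t) = (sqrt 2)\<^sup>2"
proof -
  show m: "lpp.expectation (\<lambda>\<omega>. \<omega> s - \<omega> t) = 0"
    by (simp add: integrable_coordinate expectation_coordinate)
  have sq: "lpp.expectation (\<lambda>\<omega>. (\<omega> z)\<^sup>2) = 2" for z
    using lpp.variance_eq[OF integrable_coordinate[of z] integrable_coordinate_square[of z]]
      variance_coordinate[of z] expectation_coordinate[of z] by simp
  have ind: "lpp.indep_var borel (\<lambda>\<omega>. \<omega> s) borel (\<lambda>\<omega>. \<omega> t)"
    using assms by (intro indep_var_disjoint_sites[where A="{s}" and B="{t}"])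
      (auto intro: coordinate_measurable_PiM)
  have prod: "integrable lpp_measure (\<lambda>\<omega>. \<omega> s * \<omega> t)"
    "lpp.expectation (\<lambda>\<omega>. \<omega> s * \<omega> t) = 1"
    using lpp.indep_var_integrable[OF ind integrable_coordinate integrable_coordinate]
      lpp.indep_var_lebesgue_integral[OF ind integrable_coordinate integrable_coordinate]
    by (simp_all add: expectation_coordinate)
  have eq: "(\<omega> s - \<omega> t)\<^sup>2 = (\<omega> s)\<^sup>2 - 2 * (\<omega> s * \<omega> t) + (\<omega> t)\<^sup>2" for \<omega> :: "site \<Rightarrow> real"
    by (simp add: power2_eq_square algebra_simps)
  show i: "integrable lpp_measure (\<lambda>\<omega>. (\<omega> s - \<omega> t)\<^sup>2)"
    unfolding eq using prod(1) integrable_coordinate_square by simp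
  have "lpp.expectation (\<lambda>\<omega>. (\<omega> s - \<omega> t)\<^sup>2) = 2"
    unfolding eq using prod integrable_coordinate_square by (simp add: sq)
  then show "lpp.variance (\<lambda>\<omega>. \<omega> s - \<omega> t) = (sqrt 2)\<^sup>2"
    unfolding m by simp
qed

text \<open>The \<open>j\<close>-th step compares two neighbours on one antidiagonal, and distinct
  \<open>j\<close> use distinct antidiagonals. So the steps are independent and centred, with
  variance 2; horizontal translation makes their laws equal.\<close>

lemma two_row_walk_exceeds:
  assumes "0 < \<epsilon>"
  shows "\<exists>l. \<P>(\<omega> in lpp_measure. \<forall>k\<le>l. (\<Sum>j<k. \<omega> (x + 2 + j, y) - \<omega> (x + 1 + j, y + 1)) \<le> R) < \<epsilon>"
proof (rule lpp.random_walk_exceeds[OF _ _ _ _ _ _ assms])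
  show "lpp.indep_vars (\<lambda>i. borel) (\<lambda>j \<omega>. \<omega> (x + 2 + j, y) - \<omega> (x + 1 + j, y + 1)) UNIV"
    by (rule indep_vars_disjoint_pairs) auto
  show "lpp.expectation (\<lambda>\<omega>. \<omega> (x + 2 + j, y) - \<omega> (x + 1 + j, y + 1)) = 0"
    "integrable lpp_measure (\<lambda>\<omega>. (\<omega> (x + 2 + j, y) - \<omega> (x + 1 + j, y + 1))\<^sup>2)"
    "lpp.variance (\<lambda>\<omega>. \<omega> (x + 2 + j, y) - \<omega> (x + 1 + j, y + 1)) = (sqrt 2)\<^sup>2" for j
    by (rule coordinate_difference; simp)+
  show "0 < sqrt (2 :: real)" by simp
  show "distr lpp_measure borel (\<lambda>\<omega>. \<omega> (x + 2 + j, y) - \<omega> (x + 1 + j, y + 1))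
      = distr lpp_measure borel (\<lambda>\<omega>. \<omega> (x + 2, y) - \<omega> (x + 1, y + 1))" for j
  proof -
    have "distr lpp_measure borel (\<lambda>\<omega>. \<omega> (x + 2, y) - \<omega> (x + 1, y + 1))
      = distr (distr lpp_measure lpp_measure (\<lambda>\<omega>. \<lambda>(i, i'). \<omega> (j + i, 0 + i'))) borel
          (\<lambda>\<omega>. \<omega> (x + 2, y) - \<omega> (x + 1, y + 1))"
      by (simp only: distr_shift)
    also have "\<dots> = distr lpp_measure borel (\<lambda>\<omega>. \<omega> (x + 2 + j, y) - \<omega> (x + 1 + j, y + 1))"
      by (subst distr_distr[OF _ shift_measurable]) (measurable, simp add: comp_def ac_simps)
    finally show ?thesis ..
  qed
qed

text \<open>The last-passage time from \<open>(x, y)\<close> to \<open>(X, Y)\<close>; meaningful only if \<open>x \<le> X\<close> and \<open>y \<le> Y\<close>.\<close>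

definition lpt :: "(site \<Rightarrow> real) \<Rightarrow> nat \<Rightarrow> nat \<Rightarrow> nat \<Rightarrow> nat \<Rightarrow> real" where
  "lpt \<omega> X Y x y = lp \<omega> x y (X - x) (Y - y)"

lemma lpt_ge_right: "x < X \<Longrightarrow> \<omega> (x, y) + lpt \<omega> X Y (Suc x) y \<le> lpt \<omega> X Y x y"
  using lp_Suc_ge_right[of \<omega> x y "X - Suc x" "Y - y"] by (simp add: lpt_def Suc_diff_Suc)

lemma lpt_ge_up: "y < Y \<Longrightarrow> \<omega> (x, y) + lpt \<omega> X Y x (Suc y) \<le> lpt \<omega> X Y x y"
  using lp_Suc_ge_up[of \<omega> x y "X - x" "Y - Suc y"] by (simp add: lpt_def Suc_diff_Suc)

lemma lpt_cases:
  assumes "x \<le> X" "y \<le> Y"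
  obtains "x = X" "y = Y" "lpt \<omega> X Y x y = \<omega> (x, y)"
  | "x < X" "lpt \<omega> X Y x y = \<omega> (x, y) + lpt \<omega> X Y (Suc x) y"
  | "y < Y" "lpt \<omega> X Y x y = \<omega> (x, y) + lpt \<omega> X Y x (Suc y)"
proof (cases "X - x"; cases "Y - y")
  fix k l assume k: "X - x = Suc k" and l: "Y - y = Suc l"
  then have kl: "X - Suc x = k" "Y - Suc y = l" "x < X" "y < Y" by simp_all
  show ?thesis
  proof (cases "lp \<omega> x (Suc y) (Suc k) l \<le> lp \<omega> (Suc x) y k (Suc l)")
    case True
    with k l kl show ?thesis by (intro that(2)) (simp_all add: lpt_def)
  next
    case False
    with k l kl show ?thesis by (intro that(3)) (simp_all add: lpt_def)
  qed
next
  fix k assume k: "X - x = Suc k" and l: "Y - y = 0"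
  then have "X - Suc x = k" by simp
  with k l show ?thesis using that(2) by (auto simp: lpt_def)
next
  fix l assume k: "X - x = 0" and l: "Y - y = Suc l"
  then have "Y - Suc y = l" by simp
  with k l show ?thesis using that(3) by (auto simp: lpt_def)
next
  assume "X - x = 0" "Y - y = 0"
  then show ?thesis using assms that(1) by (auto simp: lpt_def)
qed

lemma lpt_measurable [measurable]: "(\<lambda>\<omega>. lpt \<omega> X Y x y) \<in> borel_measurable lpp_measure"
  by (simp add: lpt_def)

lemma integrable_lpt: "integrable lpp_measure (\<lambda>\<omega>. lpt \<omega> X Y x y)"
  by (simp add: lpt_def integrable_lp)

lemma expectation_lpt: "lpp.expectation (\<lambda>\<omega>. lpt \<omega> X Y x y) = mean_lp (X - x) (Y - y)"
  by (simp add: lpt_def expectation_lp)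

lemma lpt_ge_row:
  assumes "x + k \<le> X"
  shows "(\<Sum>i<k. \<omega> (x + i, y)) + lpt \<omega> X Y (x + k) y \<le> lpt \<omega> X Y x y"
  using assms
proof (induction k)
  case (Suc k)
  then show ?case using lpt_ge_right[of "x + k" X \<omega> y Y] by simp
qed simp

text \<open>The loss incurred by a path that is forced to leave \<open>(x, y)\<close> to the
  right.\<close>

definition excess :: "(site \<Rightarrow> real) \<Rightarrow> nat \<Rightarrow> nat \<Rightarrow> nat \<Rightarrow> nat \<Rightarrow> real" where
  "excess \<omega> X Y x y = lpt \<omega> X Y x y - lpt \<omega> X Y (Suc x) y - \<omega> (x, y)"

text \<open>The weights of the two starting sites are left out, so that a gap only depends on the
  weights beyond the antidiagonal of these sites.\<close>

definition gap :: "(site \<Rightarrow> real) \<Rightarrow> nat \<Rightarrow> nat \<Rightarrow> nat \<Rightarrow> nat \<Rightarrow> real" where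
  "gap \<omega> X Y x y = (lpt \<omega> X Y (Suc x) y - \<omega> (Suc x, y)) - (lpt \<omega> X Y x (Suc y) - \<omega> (x, Suc y))"

lemma excess_nonneg: "x < X \<Longrightarrow> 0 \<le> excess \<omega> X Y x y"
  using lpt_ge_right[of x X \<omega> y Y] by (simp add: excess_def)

lemma lpt_row_excess:
  "lpt \<omega> X Y x y = (\<Sum>i<k. \<omega> (x + i, y) + excess \<omega> X Y (x + i) y) + lpt \<omega> X Y (x + k) y"
  by (induction k) (simp_all add: excess_def)

text \<open>From \<open>(x + 1, y)\<close>, one admissible path follows row \<open>y\<close> for
  \<open>k\<close> steps and then moves up. From \<open>(x, y + 1)\<close>, following row
  \<open>y + 1\<close> to the same site \<open>(x + 1 + k, y + 1)\<close> loses exactly the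
  excesses. The difference of the row weights is the walk.\<close>

lemma gap_ge:
  assumes "x + Suc k \<le> X" "y < Y"
  shows "(\<Sum>j<k. \<omega> (x + 2 + j, y) - \<omega> (x + 1 + j, y + 1))
      - (\<Sum>i<Suc k. excess \<omega> X Y (x + i) (Suc y)) \<le> gap \<omega> X Y x y"
proof -
  have "(\<Sum>i<k. \<omega> (Suc x + i, y)) + (\<omega> (Suc x + k, y) + lpt \<omega> X Y (Suc x + k) (Suc y))
      \<le> (\<Sum>i<k. \<omega> (Suc x + i, y)) + lpt \<omega> X Y (Suc x + k) y"
    using assms lpt_ge_up[of y Y \<omega> "Suc x + k" X] by simp
  also have "\<dots> \<le> lpt \<omega> X Y (Suc x) y"
    using assms by (intro lpt_ge_row) simp
  finally have "(\<Sum>i<Suc k. \<omega> (Suc x + i, y)) + lpt \<omega> X Y (Suc x + k) (Suc y) \<le> lpt \<omega> X Y (Suc x) y"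
    by simp
  then have a: "(\<Sum>j<k. \<omega> (x + 2 + j, y)) + lpt \<omega> X Y (Suc x + k) (Suc y)
      \<le> lpt \<omega> X Y (Suc x) y - \<omega> (Suc x, y)"
    unfolding sum.lessThan_Suc_shift by simp
  have "lpt \<omega> X Y x (Suc y) - \<omega> (x, Suc y) = (\<Sum>j<k. \<omega> (x + 1 + j, y + 1))
      + (\<Sum>i<Suc k. excess \<omega> X Y (x + i) (Suc y)) + lpt \<omega> X Y (Suc x + k) (Suc y)"
    using lpt_row_excess[of \<omega> X Y x "Suc y" "Suc k"]
    unfolding sum.distrib sum.lessThan_Suc_shift[of "\<lambda>i. \<omega> (x + i, Suc y)"] by simp
  with a show ?thesis by (simp add: gap_def sum_subtractf)
qed

text \<open>The right side is a vertical increment plus one weight: a nonnegative quantity of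
  controlled mean, to which Markov's inequality applies.\<close>

lemma gap_le:
  assumes "\<And>z. 0 \<le> \<omega> z" "x < X"
  shows "gap \<omega> X Y x y \<le> lpt \<omega> X Y x y - lpt \<omega> X Y x (Suc y) + \<omega> (x, Suc y)"
  using lpt_ge_right[of x X \<omega> y Y] assms(1)[of "(x, y)"] assms(1)[of "(Suc x, y)"] assms(2)
  by (simp add: gap_def)

lemma gap_measurable [measurable]: "(\<lambda>\<omega>. gap \<omega> X Y x y) \<in> borel_measurable lpp_measure"
  unfolding gap_def by measurable

lemma measure_bad_union_le:
  fixes N :: nat and \<delta> :: real
  assumes "\<And>a. a < N \<Longrightarrow> B a \<in> sets lpp_measure" "\<And>a. a < N \<Longrightarrow> measure lpp_measure (B a) \<le> \<delta>"
  shows "measure lpp_measure (\<Union>a<N. B a) \<le> N * \<delta>"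
proof -
  have "measure lpp_measure (\<Union>a<N. B a) \<le> (\<Sum>a<N. measure lpp_measure (B a))"
    using assms by (intro measure_UNION_le) auto
  also have "\<dots> \<le> (\<Sum>a<N. \<delta>)" using assms by (intro sum_mono) auto
  finally show ?thesis by simp
qed

text \<open>For targets in a nearly horizontal direction, moving to the right costs little more than the
  weights met, so along the two rows the gap dominates a recurrent random walk.\<close>

lemma gaps_between_with_high_probability:
  fixes R \<epsilon> :: real and N :: nat
  assumes \<epsilon>: "0 < \<epsilon>"
  shows "\<exists>R'. \<forall>K. \<exists>X Y. K \<le> X \<and> K \<le> Y \<and>
    1 - \<epsilon> \<le> \<P>(\<omega> in lpp_measure. \<forall>a<N. R < gap \<omega> X Y a (N - 1 - a) \<and> gap \<omega> X Y a (N - 1 - a) < R')"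
proof -
  \<comment> \<open>There are three bad events for each of the \<open>N\<close> gaps.\<close>
  define \<delta> where "\<delta> = \<epsilon> / (3 * (N + 1))"
  have \<delta>: "0 < \<delta>" using \<epsilon> by (simp add: \<delta>_def)
  define W where "W a k \<omega> = (\<Sum>j<k. \<omega> (a + 2 + j, N - 1 - a) - \<omega> (a + 1 + j, N - 1 - a + 1))"
    for a k and \<omega> :: "site \<Rightarrow> real"
  have W[measurable]: "W a k \<in> borel_measurable lpp_measure" for a k unfolding W_def by measurable
  \<comment> \<open>The walk has to exceed \<open>R + 1\<close>; the extra 1 pays for the total
    excess, which stays below 1 outside \<open>B2\<close>.\<close>
  have "\<forall>a. \<exists>l. \<P>(\<omega> in lpp_measure. \<forall>k\<le>l. W a k \<omega> \<le> R + 1) < \<delta>"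
    unfolding W_def using \<delta> by (intro allI two_row_walk_exceeds)
  from choice[OF this]
  obtain L where L: "\<And>a. \<P>(\<omega> in lpp_measure. \<forall>k\<le>L a. W a k \<omega> \<le> R + 1) < \<delta>" by blast
  \<comment> \<open>A common horizon: the sum dominates each \<open>L a\<close>. The at most
    \<open>l + 1\<close> excesses along a row, each of mean at most \<eta>, then have total mean at
    most \<delta>.\<close>
  define l where "l = (\<Sum>a<N. L a)"
  have Ll: "L a \<le> l" if "a < N" for a using that unfolding l_def by (intro member_le_sum) auto
  define w where "w = N + l + 2"
  define \<eta> where "\<eta> = \<delta> / (l + 1)"
  have \<eta>: "0 < \<eta>" using \<delta> by (simp add: \<eta>_def)
  obtain C :: real where C: "0 < C"
    "\<And>K. \<exists>X Y. K \<le> X \<and> K \<le> Y \<and> (\<forall>i<w. \<forall>j<w.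
       mean_lp (Suc (X + i)) (Y + j) - mean_lp (X + i) (Y + j) - 1 \<le> \<eta> \<and>
       mean_lp (X + i) (Suc (Y + j)) - mean_lp (X + i) (Y + j) \<le> C)"
    by (rule window_with_small_increments[OF \<eta>, of w]) (rule that, assumption, blast)
  define R' where "R' = (C + 1) / \<delta>"
  have R': "0 < R'" using C(1) \<delta> by (simp add: R'_def)
  show ?thesis
  proof (intro exI[of _ R'] allI)
    fix K
    obtain X0 Y0 where XY0: "K \<le> X0" "K \<le> Y0" "\<And>i j. i < w \<Longrightarrow> j < w \<Longrightarrow>
       mean_lp (Suc (X0 + i)) (Y0 + j) - mean_lp (X0 + i) (Y0 + j) - 1 \<le> \<eta>"
      "\<And>i j. i < w \<Longrightarrow> j < w \<Longrightarrow> mean_lp (X0 + i) (Suc (Y0 + j)) - mean_lp (X0 + i) (Y0 + j) \<le> C"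
      using C(2)[of K] by blast
    \<comment> \<open>The target is the upper corner of the window, so the displacements to it from
      all sites with \<open>a < N\<close> and \<open>i \<le> l\<close> stay inside the window;
      \<open>w\<close> is large enough that no subtraction truncates.\<close>
    define X Y where "X = X0 + (w - 1)" and "Y = Y0 + (w - 1)"
    define E where "E a \<omega> = (\<Sum>i<Suc l. excess \<omega> X Y (a + i) (Suc (N - 1 - a)))" for a \<omega>
    define J where "J a \<omega> = lpt \<omega> X Y a (N - 1 - a) - lpt \<omega> X Y a (Suc (N - 1 - a))
      + \<omega> (a, Suc (N - 1 - a))" for a \<omega>
    have E[measurable]: "E a \<in> borel_measurable lpp_measure" for a
      unfolding E_def excess_def by measurable
    have J[measurable]: "J a \<in> borel_measurable lpp_measure" for a
      unfolding J_def by measurable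
    define B1 where "B1 a = {\<omega>\<in>space lpp_measure. \<forall>k\<le>L a. W a k \<omega> \<le> R + 1}" for a
    define B2 where "B2 a = {\<omega>\<in>space lpp_measure. 1 \<le> E a \<omega>}" for a
    define B3 where "B3 a = {\<omega>\<in>space lpp_measure. R' \<le> J a \<omega>}" for a
    have B[measurable]: "B1 a \<in> sets lpp_measure" "B2 a \<in> sets lpp_measure" "B3 a \<in> sets lpp_measure" for a
      unfolding B1_def B2_def B3_def by measurable
    have ax: "a + i < X" "Suc (N - 1 - a) \<le> Y" if "a < N" "i \<le> l" for a i
      using that by (auto simp: X_def Y_def w_def)
    have E0: "0 \<le> E a \<omega>" if "a < N" for a \<omega>
      unfolding E_def using that by (intro sum_nonneg excess_nonneg ax) auto
    have J0: "gap \<omega> X Y a (N - 1 - a) \<le> J a \<omega>" if "a < N" "\<omega> \<in> space lpp_measure" for a \<omega>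
      unfolding J_def using that ax[of a 0] by (intro gap_le coordinate_nonneg) auto
    have J0': "0 \<le> J a \<omega>" if "a < N" "\<omega> \<in> space lpp_measure" for a \<omega>
    proof -
      have "N - 1 - a < Y" using ax(2)[of a 0] that(1) by simp
      from lpt_ge_up[OF this, of \<omega> a X] show ?thesis
        using coordinate_nonneg[OF that(2), of "(a, N - 1 - a)"]
          coordinate_nonneg[OF that(2), of "(a, Suc (N - 1 - a))"]
        unfolding J_def by linarith
    qed
    have Ei: "integrable lpp_measure (E a)" for a
      unfolding E_def excess_def
      by (intro Bochner_Integration.integrable_sum Bochner_Integration.integrable_diff integrable_lpt integrable_coordinate)
    have Ji: "integrable lpp_measure (J a)" for a
      unfolding J_def
      by (intro Bochner_Integration.integrable_add Bochner_Integration.integrable_diff integrable_lpt integrable_coordinate)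
    have EE: "lpp.expectation (E a) \<le> \<delta>" if a: "a < N" for a
    proof -
      have "lpp.expectation (\<lambda>\<omega>. excess \<omega> X Y (a + i) (Suc (N - 1 - a))) \<le> \<eta>" if "i < Suc l" for i
      proof -
        have 1: "X - (a + i) = Suc (X0 + (w - 2 - a - i))" "X - Suc (a + i) = X0 + (w - 2 - a - i)"
          "Y - Suc (N - 1 - a) = Y0 + (w - 1 - N + a)" "w - 2 - a - i < w" "w - 1 - N + a < w"
          using a that by (auto simp: X_def Y_def w_def)
        have "lpp.expectation (\<lambda>\<omega>. excess \<omega> X Y (a + i) (Suc (N - 1 - a)))
            = mean_lp (X - (a + i)) (Y - Suc (N - 1 - a)) - mean_lp (X - Suc (a + i)) (Y - Suc (N - 1 - a)) - 1"
          unfolding excess_def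
          by (simp add: integrable_lpt integrable_coordinate expectation_lpt expectation_coordinate)
        also have "\<dots> \<le> \<eta>" unfolding 1(1-3) by (rule XY0(3)[OF 1(4,5)])
        finally show ?thesis .
      qed
      then have "(\<Sum>i<Suc l. lpp.expectation (\<lambda>\<omega>. excess \<omega> X Y (a + i) (Suc (N - 1 - a)))) \<le> (\<Sum>i<Suc l. \<eta>)"
        by (intro sum_mono) auto
      also have "\<dots> = \<delta>" by (simp add: \<eta>_def field_simps)
      finally show ?thesis
        unfolding E_def using integrable_lpt integrable_coordinate
        by (subst Bochner_Integration.integral_sum) (auto simp: excess_def)
    qed
    have EJ: "lpp.expectation (J a) \<le> C + 1" if a: "a < N" for a
    proof -
      have 1: "X - a = X0 + (w - 1 - a)" "Y - Suc (N - 1 - a) = Y0 + (w - 1 - N + a)"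
        "Y - (N - 1 - a) = Suc (Y0 + (w - 1 - N + a))" "w - 1 - a < w" "w - 1 - N + a < w"
        using a by (auto simp: X_def Y_def w_def)
      have "lpp.expectation (J a) = mean_lp (X - a) (Y - (N - 1 - a)) - mean_lp (X - a) (Y - Suc (N - 1 - a)) + 1"
        unfolding J_def
        by (simp add: integrable_lpt integrable_coordinate expectation_lpt expectation_coordinate)
      also have "\<dots> \<le> C + 1" unfolding 1(1-3) using XY0(4)[OF 1(4,5)] by simp
      finally show ?thesis .
    qed
    have b1: "measure lpp_measure (B1 a) \<le> \<delta>" for a
      using L[of a] by (simp add: B1_def)
    have b2: "measure lpp_measure (B2 a) \<le> \<delta>" if "a < N" for a
    proof -
      have "measure lpp_measure (B2 a) \<le> lpp.expectation (E a) / 1"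
        unfolding B2_def using E0[OF that] Ei
        by (intro integral_Markov_inequality_measure[where A="{}"]) auto
      with EE[OF that] show ?thesis by simp
    qed
    have b3: "measure lpp_measure (B3 a) \<le> \<delta>" if "a < N" for a
    proof -
      have "measure lpp_measure (B3 a) \<le> lpp.expectation (J a) / R'"
        unfolding B3_def using J0'[OF that] Ji R'
        by (intro integral_Markov_inequality_measure[where A="{}"]) auto
      also have "\<dots> \<le> (C + 1) / R'" using EJ[OF that] R' by (intro divide_right_mono) auto
      also have "\<dots> = \<delta>" using C(1) \<delta> by (simp add: R'_def)
      finally show ?thesis .
    qed
    have "measure lpp_measure (B1 a \<union> B2 a \<union> B3 a) \<le> 3 * \<delta>" if "a < N" for a
      using measure_Un_le[of "B1 a \<union> B2 a" lpp_measure "B3 a"] measure_Un_le[of "B1 a" lpp_measure "B2 a"]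
        b1[of a] b2[OF that] b3[OF that] B by auto
    then have "measure lpp_measure (\<Union>a<N. B1 a \<union> B2 a \<union> B3 a) \<le> N * (3 * \<delta>)"
      by (intro measure_bad_union_le) auto
    also have "\<dots> \<le> \<epsilon>" using \<epsilon> by (simp add: \<delta>_def field_simps)
    finally have bad: "measure lpp_measure (\<Union>a<N. B1 a \<union> B2 a \<union> B3 a) \<le> \<epsilon>" .
    have "1 - \<epsilon> \<le> measure lpp_measure (space lpp_measure - (\<Union>a<N. B1 a \<union> B2 a \<union> B3 a))"
      using bad by (subst lpp.prob_compl) auto
    also have "\<dots> \<le> \<P>(\<omega> in lpp_measure. \<forall>a<N. R < gap \<omega> X Y a (N - 1 - a) \<and> gap \<omega> X Y a (N - 1 - a) < R')"
    proof (intro lpp.finite_measure_mono subsetI)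
      fix \<omega> assume \<omega>: "\<omega> \<in> space lpp_measure - (\<Union>a<N. B1 a \<union> B2 a \<union> B3 a)"
      have "R < gap \<omega> X Y a (N - 1 - a) \<and> gap \<omega> X Y a (N - 1 - a) < R'" if a: "a < N" for a
      proof
        from \<omega> a obtain k where k: "k \<le> L a" "R + 1 < W a k \<omega>"
          by (auto simp: B1_def not_le)
        from \<omega> a have e: "E a \<omega> < 1" and j: "J a \<omega> < R'" by (auto simp: B2_def B3_def not_le)
        have kl: "k \<le> l" using k(1) Ll[OF a] by simp
        have "(\<Sum>i<Suc k. excess \<omega> X Y (a + i) (Suc (N - 1 - a))) \<le> E a \<omega>"
          unfolding E_def using kl a ax by (intro sum_mono2 excess_nonneg) auto
        moreover have "W a k \<omega> - (\<Sum>i<Suc k. excess \<omega> X Y (a + i) (Suc (N - 1 - a)))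
            \<le> gap \<omega> X Y a (N - 1 - a)"
          unfolding W_def using ax[OF a kl] by (intro gap_ge) auto
        ultimately show "R < gap \<omega> X Y a (N - 1 - a)" using k(2) e by linarith
        show "gap \<omega> X Y a (N - 1 - a) < R'" using J0[OF a] j \<omega> by fastforce
      qed
      with \<omega> show "\<omega> \<in> {\<omega>\<in>space lpp_measure. \<forall>a<N. R < gap \<omega> X Y a (N - 1 - a) \<and> gap \<omega> X Y a (N - 1 - a) < R'}"
        by auto
    qed measurable
    finally have "1 - \<epsilon> \<le> \<P>(\<omega> in lpp_measure. \<forall>a<N. R < gap \<omega> X Y a (N - 1 - a) \<and> gap \<omega> X Y a (N - 1 - a) < R')" .
    moreover have "K \<le> X" "K \<le> Y" using XY0(1,2) by (auto simp: X_def Y_def)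
    ultimately show "\<exists>X Y. K \<le> X \<and> K \<le> Y \<and>
      1 - \<epsilon> \<le> \<P>(\<omega> in lpp_measure. \<forall>a<N. R < gap \<omega> X Y a (N - 1 - a) \<and> gap \<omega> X Y a (N - 1 - a) < R')"
      by blast
  qed
qed

section \<open>Paths and geodesics\<close>

abbreviation path_step :: "site \<Rightarrow> site \<Rightarrow> bool" where
  "path_step u v \<equiv> v = u + (1, 0) \<or> v = u + (0, 1)"

text \<open>The starting site is free, so that paths can be cut at the antidiagonal and
  concatenated.\<close>

definition walk :: "site \<Rightarrow> site \<Rightarrow> site list \<Rightarrow> bool" where
  "walk u z p \<longleftrightarrow> p \<noteq> [] \<and> hd p = u \<and> last p = z \<and> successively path_step p"

lemma successively_iff_nth:
  "successively P xs \<longleftrightarrow> (\<forall>i. Suc i < length xs \<longrightarrow> P (xs ! i) (xs ! Suc i))"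
proof (induction P xs rule: successively.induct)
  case (3 P x y xs)
  show ?case
    unfolding successively.simps 3 by (auto simp: less_Suc_eq_0_disj nth_Cons split: nat.splits)
qed auto

lemma directed_paths_eq_walks: "directed_paths z = {p. walk (0, 0) z p}"
  unfolding directed_paths_def walk_def successively_iff_nth by auto

lemma walk_Cons_Cons:
  "walk (x, y) z (u # v # p) \<longleftrightarrow> u = (x, y) \<and>
    (v = (Suc x, y) \<and> walk (Suc x, y) z (v # p) \<or> v = (x, Suc y) \<and> walk (x, Suc y) z (v # p))"
  by (auto simp: walk_def)

text \<open>Together with \<open>walk_attaining_lpt\<close>, this identifies the recursively defined
  \<open>lpt\<close> with a maximum over paths.\<close>

lemma walk_sum_le_lpt:
  assumes "walk (x, y) (X, Y) p"
  shows "x \<le> X" "y \<le> Y" "sum_list (map \<omega> p) \<le> lpt \<omega> X Y x y"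
proof -
  have "x \<le> X \<and> y \<le> Y \<and> sum_list (map \<omega> p) \<le> lpt \<omega> X Y x y"
    using assms
  proof (induction p arbitrary: x y rule: induct_list012)
    case 1 then show ?case by (simp add: walk_def)
  next
    case (2 u) then show ?case by (auto simp: walk_def lpt_def)
  next
    case (3 u v p)
    then show ?case
      unfolding walk_Cons_Cons
      using lpt_ge_right[of x X \<omega> y Y] lpt_ge_up[of y Y \<omega> x X] by fastforce
  qed
  then show "x \<le> X" "y \<le> Y" "sum_list (map \<omega> p) \<le> lpt \<omega> X Y x y" by auto
qed

lemma walk_attaining_lpt:
  assumes "x \<le> X" "y \<le> Y"
  shows "\<exists>p. walk (x, y) (X, Y) p \<and> sum_list (map \<omega> p) = lpt \<omega> X Y x y"
  using assms
proof (induction "X - x + (Y - y)" arbitrary: x y rule: less_induct)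
  case less
  have ext: "walk (x, y) (X, Y) ((x, y) # p)"
    if "walk (Suc x, y) (X, Y) p \<or> walk (x, Suc y) (X, Y) p" for p
    using that by (cases p) (auto simp: walk_def)
  from less(2,3) show ?case
  proof (cases rule: lpt_cases[where \<omega> = \<omega>])
    case 1
    then show ?thesis by (intro exI[of _ "[(x, y)]"]) (simp add: walk_def)
  next
    case 2
    then have "X - Suc x + (Y - y) < X - x + (Y - y)" by simp
    with 2 less(3) obtain p where "walk (Suc x, y) (X, Y) p" "sum_list (map \<omega> p) = lpt \<omega> X Y (Suc x) y"
      using less(1)[of "Suc x" y] by (meson Suc_leI)
    with 2 ext[of p] show ?thesis by (intro exI[of _ "(x, y) # p"]) simp
  next
    case 3
    then have "X - x + (Y - Suc y) < X - x + (Y - y)" by simp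
    with 3 less(2) obtain p where "walk (x, Suc y) (X, Y) p" "sum_list (map \<omega> p) = lpt \<omega> X Y x (Suc y)"
      using less(1)[of x "Suc y"] by (meson Suc_leI)
    with 3 ext[of p] show ?thesis by (intro exI[of _ "(x, y) # p"]) simp
  qed
qed

lemma walk_append:
  assumes "walk u v p" "walk v z q"
  shows "walk u z (p @ tl q)"
    and "sum_list (map \<omega> (p @ tl q)) = sum_list (map \<omega> p) + sum_list (map \<omega> q) - (\<omega> v :: real)"
proof -
  from assms obtain r where q: "q = v # r" by (cases q) (auto simp: walk_def)
  show "walk u z (p @ tl q)"
    using assms unfolding q by (auto simp: walk_def successively_append_iff successively_Cons)
  show "sum_list (map \<omega> (p @ tl q)) = sum_list (map \<omega> p) + sum_list (map \<omega> q) - \<omega> v"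
    unfolding q by simp
qed

lemma walk_drop:
  assumes "walk u z p" "k < length p"
  shows "walk (p ! k) z (drop k p)"
  using assms successively_append_iff[of _ "take k p" "drop k p"]
  by (auto simp: walk_def hd_drop_conv_nth)

text \<open>Each step raises the coordinate sum by one. Hence paths are duplicate-free, finite in
  number for a given endpoint, and meet each antidiagonal at a fixed position.\<close>

lemma walk_level:
  assumes "walk (0, 0) z p" "i < length p"
  shows "fst (p ! i) + snd (p ! i) = i"
  using assms(2)
proof (induction i)
  case 0
  then show ?case using assms(1) by (simp add: walk_def hd_conv_nth[symmetric])
next
  case (Suc i)
  then have "path_step (p ! i) (p ! Suc i)"
    using assms(1) unfolding walk_def successively_iff_nth by blast
  with Suc show ?case by auto
qed

lemma walk_length: "walk (0, 0) z p \<Longrightarrow> length p = Suc (fst z + snd z)"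
  using walk_level[of z p "length p - 1"] by (auto simp: walk_def last_conv_nth)

lemma walk_distinct: "walk (0, 0) z p \<Longrightarrow> distinct p"
  unfolding distinct_conv_nth using walk_level by metis

lemma finite_directed_paths: "finite (directed_paths z)"
proof (rule finite_subset)
  let ?m = "fst z + snd z"
  show "directed_paths z \<subseteq> {p. set p \<subseteq> {..?m} \<times> {..?m} \<and> length p = Suc ?m}"
  proof
    fix p assume "p \<in> directed_paths z"
    then have p: "walk (0, 0) z p" by (simp add: directed_paths_eq_walks)
    have "fst u \<le> ?m \<and> snd u \<le> ?m" if "u \<in> set p" for u
    proof -
      from that obtain i where "i < length p" "u = p ! i" by (metis in_set_conv_nth)
      with walk_level[OF p this(1)] walk_length[OF p] show ?thesis by auto
    qed
    with walk_length[OF p] show "p \<in> {p. set p \<subseteq> {..?m} \<times> {..?m} \<and> length p = Suc ?m}"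
      by (auto simp: mem_Times_iff)
  qed
qed (intro finite_lists_length_eq finite_cartesian_product finite_atMost)

lemma passage_time_walk: "walk (0, 0) z p \<Longrightarrow> passage_time \<omega> p = sum_list (map \<omega> p)"
  unfolding passage_time_def by (rule sum.distinct_set_conv_list[OF walk_distinct])

lemma directed_paths_nonempty: "directed_paths z \<noteq> {}"
  using walk_attaining_lpt[of 0 "fst z" 0 "snd z"] by (auto simp: directed_paths_eq_walks)

lemma passage_time_le_last_passage_time:
  "p \<in> directed_paths z \<Longrightarrow> passage_time \<omega> p \<le> last_passage_time \<omega> z"
  unfolding last_passage_time_def by (intro Max_ge) (auto simp: finite_directed_paths)

lemma last_passage_time_attained:
  "\<exists>p\<in>directed_paths z. passage_time \<omega> p = last_passage_time \<omega> z"
proof -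
  have "last_passage_time \<omega> z \<in> passage_time \<omega> ` directed_paths z"
    unfolding last_passage_time_def
    by (intro Max_in) (auto simp: finite_directed_paths directed_paths_nonempty)
  then show ?thesis by auto
qed

text \<open>A path crossing the antidiagonal elsewhere collects at most \<open>N\<close> from the
  \<open>N\<close> sites below it and at most \<open>lpt\<close> from its crossing site on, which is
  less than what the paths through \<open>(i, N - i)\<close> achieve.\<close>

lemma maximal_path_through:
  assumes nonneg: "\<And>z. 0 \<le> \<omega> z" and low: "\<And>z. fst z + snd z < N \<Longrightarrow> \<omega> z \<le> 1"
    and i: "i \<le> N" "i \<le> X" "N - i \<le> Y"
    and less: "\<And>a. a \<le> N \<Longrightarrow> a \<noteq> i \<Longrightarrow> lpt \<omega> X Y a (N - a) + N < lpt \<omega> X Y i (N - i)"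
    and p: "p \<in> directed_paths (X, Y)" "passage_time \<omega> p = last_passage_time \<omega> (X, Y)"
  shows "(i, N - i) \<in> set p"
proof (rule ccontr)
  assume notin: "(i, N - i) \<notin> set p"
  have wp: "walk (0, 0) (X, Y) p" using p by (simp add: directed_paths_eq_walks)
  have len: "N < length p" using walk_length[OF wp] i by simp
  obtain a b where ab: "p ! N = (a, b)" by (cases "p ! N")
  then have a: "a \<le> N" "b = N - a" using walk_level[OF wp len] by auto
  have "a \<noteq> i" using notin nth_mem[OF len] ab a by auto
  have "sum_list (map \<omega> (take N p)) \<le> N"
  proof -
    have "\<omega> u \<le> 1" if u: "u \<in> set (take N p)" for u
    proof -
      from u obtain j where "j < N" "u = p ! j" using len by (auto simp: in_set_conv_nth)
      with walk_level[OF wp, of j] len show ?thesis by (intro low) auto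
    qed
    then have "sum_list (map \<omega> (take N p)) \<le> sum_list (map (\<lambda>_. 1) (take N p))"
      by (intro sum_list_mono)
    with len show ?thesis by (simp add: sum_list_triv)
  qed
  moreover have "sum_list (map \<omega> (drop N p)) \<le> lpt \<omega> X Y a (N - a)"
    using walk_drop[OF wp len] by (intro walk_sum_le_lpt(3)) (simp add: ab a)
  moreover have "sum_list (map \<omega> p) = sum_list (map \<omega> (take N p)) + sum_list (map \<omega> (drop N p))"
    by (metis append_take_drop_id map_append sum_list_append)
  ultimately have "passage_time \<omega> p \<le> N + lpt \<omega> X Y a (N - a)"
    using passage_time_walk[OF wp, of \<omega>] by linarith
  also have "\<dots> < lpt \<omega> X Y i (N - i)"
    using less[OF a(1) \<open>a \<noteq> i\<close>] by simp
  \<comment> \<open>The competitor is any path to \<open>(i, N - i)\<close> followed by an optimal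
    continuation; the nonnegative weights of the first piece cover the junction weight counted in
    both.\<close>
  also have "\<dots> \<le> last_passage_time \<omega> (X, Y)"
  proof -
    obtain q where q: "walk (i, N - i) (X, Y) q" "sum_list (map \<omega> q) = lpt \<omega> X Y i (N - i)"
      using walk_attaining_lpt[OF i(2,3)] by blast
    obtain r where r: "walk (0, 0) (i, N - i) r"
      using walk_attaining_lpt[of 0 i 0 "N - i"] by blast
    then have "(i, N - i) \<in> set r" unfolding walk_def by (metis last_in_set)
    then have "\<omega> (i, N - i) \<le> sum_list (map \<omega> r)"
      using nonneg by (intro member_le_sum_list) auto
    then have "lpt \<omega> X Y i (N - i) \<le> passage_time \<omega> (r @ tl q)"
      using passage_time_walk[OF walk_append(1)[OF r q(1)], of \<omega>] walk_append(2)[OF r q(1), of \<omega>] q(2)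
      by linarith
    also have "\<dots> \<le> last_passage_time \<omega> (X, Y)"
      using walk_append(1)[OF r q(1)]
      by (intro passage_time_le_last_passage_time) (simp add: directed_paths_eq_walks)
    finally show ?thesis .
  qed
  finally show False using p(2) by simp
qed

section \<open>Almost sure uniqueness of geodesics and measurability of coexistence\<close>

definition distinct_passage_times :: "(site \<Rightarrow> real) \<Rightarrow> bool" where
  "distinct_passage_times \<omega> \<longleftrightarrow>
     (\<forall>p q z. p \<in> directed_paths z \<longrightarrow> q \<in> directed_paths z \<longrightarrow> p \<noteq> q \<longrightarrow> passage_time \<omega> p \<noteq> passage_time \<omega> q)"

lemma geodesic_maximal:
  assumes "distinct_passage_times \<omega>"
  shows "geodesic \<omega> z \<in> directed_paths z" "passage_time \<omega> (geodesic \<omega> z) = last_passage_time \<omega> z"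
proof -
  obtain p where p: "p \<in> directed_paths z" "passage_time \<omega> p = last_passage_time \<omega> z"
    using last_passage_time_attained by blast
  have "geodesic \<omega> z \<in> directed_paths z \<and> passage_time \<omega> (geodesic \<omega> z) = last_passage_time \<omega> z"
    unfolding geodesic_def
  proof (rule theI[of _ p])
    fix q assume "q \<in> directed_paths z \<and> passage_time \<omega> q = last_passage_time \<omega> z"
    with p assms show "q = p" unfolding distinct_passage_times_def by metis
  qed (use p in simp)
  then show "geodesic \<omega> z \<in> directed_paths z" "passage_time \<omega> (geodesic \<omega> z) = last_passage_time \<omega> z"
    by auto
qed

text \<open>By independence the joint law is a product, and by Fubini the diagonal is null because
  the law of one weight has a density and hence no atoms.\<close>

lemma AE_coordinate_neq_independent:
  assumes ind: "lpp.indep_var borel (\<lambda>\<omega>. \<omega> s) borel Y"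
  shows "AE \<omega> in lpp_measure. \<omega> s \<noteq> (Y \<omega> :: real)"
proof -
  have [measurable]: "Y \<in> borel_measurable lpp_measure" using lpp.indep_var_rv2[OF ind] .
  let ?S = "distr lpp_measure borel (\<lambda>\<omega>. \<omega> s)" and ?T = "distr lpp_measure borel Y"
  interpret S: prob_space ?S by (rule lpp.prob_space_distr) measurable
  interpret T: prob_space ?T by (rule lpp.prob_space_distr) measurable
  interpret ST: pair_sigma_finite ?S ?T ..
  define D where "D = {v :: real \<times> real. fst v = snd v}"
  have D: "D \<in> sets (borel \<Otimes>\<^sub>M borel)"
  proof -
    have "{v\<in>space (borel \<Otimes>\<^sub>M borel). fst v = (snd v :: real)} \<in> sets (borel \<Otimes>\<^sub>M borel)"
      by measurable
    then show ?thesis by (simp add: D_def space_pair_measure)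
  qed
  have null: "emeasure ?S {y} = 0" for y
  proof -
    have "emeasure ?S {y} = emeasure (distr lpp_measure lborel (\<lambda>\<omega>. \<omega> s)) {y}"
      by (simp add: emeasure_distr)
    also have "\<dots> = emeasure (density lborel (exponential_density 1)) {y}"
      using distributed_coordinate[of s] by (simp add: distributed_def)
    also have "\<dots> = 0"
      by (subst emeasure_density)
        (auto simp: nn_integral_0_iff_AE intro: AE_mp[OF AE_lborel_singleton[of y]])
    finally show ?thesis .
  qed
  have "emeasure lpp_measure {\<omega>\<in>space lpp_measure. \<omega> s = Y \<omega>}
      = emeasure (distr lpp_measure (borel \<Otimes>\<^sub>M borel) (\<lambda>\<omega>. (\<omega> s, Y \<omega>))) D"
    using D by (subst emeasure_distr) (auto simp: D_def intro!: arg_cong[where f="emeasure lpp_measure"])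
  also have "distr lpp_measure (borel \<Otimes>\<^sub>M borel) (\<lambda>\<omega>. (\<omega> s, Y \<omega>)) = ?S \<Otimes>\<^sub>M ?T"
    using ind unfolding lpp.indep_var_distribution_eq by simp
  also have "emeasure (?S \<Otimes>\<^sub>M ?T) D = (\<integral>\<^sup>+y. emeasure ?S ((\<lambda>x. (x, y)) -` D) \<partial>?T)"
    by (rule ST.emeasure_pair_measure_alt2) (use D in \<open>simp add: sets_pair_measure_cong[OF sets_distr sets_distr]\<close>)
  also have "\<dots> = (\<integral>\<^sup>+y. 0 \<partial>?T)"
    by (intro nn_integral_cong) (simp add: D_def vimage_def null)
  finally have "emeasure lpp_measure {\<omega>\<in>space lpp_measure. \<omega> s = Y \<omega>} = 0" by simp
  then show ?thesis by (subst AE_iff_measurable[of "{\<omega>\<in>space lpp_measure. \<omega> s = Y \<omega>}"]) auto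
qed

text \<open>Two distinct paths to \<open>z\<close> differ at some position; by the levels, the site
  \<open>s\<close> of the first path there is not on the second. Equal passage times would make the
  weight of \<open>s\<close> a function of the other weights. There are countably many triples of
  two paths and an endpoint.\<close>

lemma AE_distinct_passage_times: "AE \<omega> in lpp_measure. distinct_passage_times \<omega>"
proof -
  have neq: "AE \<omega> in lpp_measure. passage_time \<omega> p \<noteq> passage_time \<omega> q"
    if pq: "p \<in> directed_paths z" "q \<in> directed_paths z" "p \<noteq> q" for p q z
  proof -
    have w: "walk (0, 0) z p" "walk (0, 0) z q" using pq by (auto simp: directed_paths_eq_walks)
    have len: "length p = length q" using w walk_length by simp
    then obtain i where i: "i < length p" "p ! i \<noteq> q ! i"
      using pq(3) nth_equalityI by blast
    define s where "s = p ! i"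
    have sp: "s \<in> set p" using i by (simp add: s_def)
    have sq: "s \<notin> set q"
    proof
      assume "s \<in> set q"
      then obtain j where "j < length q" "q ! j = s" by (auto simp: in_set_conv_nth)
      with walk_level[OF w(1) i(1)] walk_level[OF w(2), of j] i show False
        by (auto simp: s_def)
    qed
    define Y where "Y \<omega> = (\<Sum>u\<in>set q. \<omega> u) - (\<Sum>u\<in>set p - {s}. \<omega> u)" for \<omega> :: "site \<Rightarrow> real"
    have "lpp.indep_var borel (\<lambda>\<omega>. \<omega> s) borel Y"
    proof (rule indep_var_disjoint_sites)
      show "{s} \<inter> - {s} = {}" by simp
      show "(\<lambda>\<omega>. \<omega> s) \<in> borel_measurable (PiM {s} (\<lambda>_. exp1_measure))"
        by (rule coordinate_measurable_PiM) simp
      show "Y \<in> borel_measurable (PiM (- {s}) (\<lambda>_. exp1_measure))"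
        unfolding Y_def using sq
        by (intro borel_measurable_diff borel_measurable_sum coordinate_measurable_PiM) auto
      show "Y (restrict \<omega> (- {s})) = Y \<omega>" for \<omega>
        unfolding Y_def using sq by (intro arg_cong2[where f="(-)"] sum.cong) auto
    qed simp
    from AE_coordinate_neq_independent[OF this] show ?thesis
    proof eventually_elim
      fix \<omega> :: "site \<Rightarrow> real" assume "\<omega> s \<noteq> Y \<omega>"
      moreover have "(\<Sum>u\<in>set p. \<omega> u) = \<omega> s + (\<Sum>u\<in>set p - {s}. \<omega> u)"
        using sp by (intro sum.remove) auto
      ultimately show "passage_time \<omega> p \<noteq> passage_time \<omega> q"
        by (auto simp: passage_time_def Y_def)
    qed
  qed
  have "AE \<omega> in lpp_measure. p \<in> directed_paths z \<longrightarrow> q \<in> directed_paths z \<longrightarrow> p \<noteq> q \<longrightarrow>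
      passage_time \<omega> p \<noteq> passage_time \<omega> q" for p q z
    using neq[of p z q] by (cases "p \<in> directed_paths z \<and> q \<in> directed_paths z \<and> p \<noteq> q") auto
  then show ?thesis unfolding distinct_passage_times_def by (simp add: AE_all_countable)
qed

lemma passage_time_measurable [measurable]: "(\<lambda>\<omega>. passage_time \<omega> p) \<in> borel_measurable lpp_measure"
  unfolding passage_time_def by measurable

text \<open>Even where the maximiser is not unique, \<open>geodesic\<close> is a function of the set
  of maximising paths. This set has finitely many possible values, each described by finitely many
  comparisons of passage times.\<close>

lemma sets_subtree_vertices: "{\<omega>\<in>space lpp_measure. z \<in> subtree_vertices \<omega> v} \<in> sets lpp_measure"
proof -
  define A where "A \<omega> = {p\<in>directed_paths z. passage_time \<omega> p = last_passage_time \<omega> z}" for \<omega>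
  have eq: "A \<omega> = S \<longleftrightarrow> (\<forall>p\<in>directed_paths z. (\<forall>q\<in>directed_paths z. passage_time \<omega> q \<le> passage_time \<omega> p) \<longleftrightarrow> p \<in> S)"
    if "S \<subseteq> directed_paths z" for \<omega> S
  proof -
    have "passage_time \<omega> p = last_passage_time \<omega> z \<longleftrightarrow>
        (\<forall>q\<in>directed_paths z. passage_time \<omega> q \<le> passage_time \<omega> p)" if "p \<in> directed_paths z" for p
      using that passage_time_le_last_passage_time last_passage_time_attained[of z \<omega>]
      by (metis order_antisym)
    with that show ?thesis unfolding A_def by auto
  qed
  have [measurable]: "{\<omega>\<in>space lpp_measure. A \<omega> = S} \<in> sets lpp_measure" if "S \<subseteq> directed_paths z" for S
  proof -
    have "{\<omega>\<in>space lpp_measure. passage_time \<omega> q \<le> passage_time \<omega> p} \<in> sets lpp_measure" for p q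
      by measurable
    then have max: "{\<omega>\<in>space lpp_measure. \<forall>q\<in>directed_paths z. passage_time \<omega> q \<le> passage_time \<omega> p}
        \<in> sets lpp_measure" for p
      by (intro sets.sets_Collect_finite_All finite_directed_paths)
    have "{\<omega>\<in>space lpp_measure. (\<forall>q\<in>directed_paths z. passage_time \<omega> q \<le> passage_time \<omega> p) \<longleftrightarrow> p \<in> S}
        \<in> sets lpp_measure" for p
      by (cases "p \<in> S") (use max[of p] sets.sets_Collect_neg[OF max[of p]] in simp_all)
    then show ?thesis
      unfolding eq[OF that] by (intro sets.sets_Collect_finite_All finite_directed_paths)
  qed
  have "{\<omega>\<in>space lpp_measure. z \<in> subtree_vertices \<omega> v}
      = (\<Union>S\<in>{S\<in>Pow (directed_paths z). v \<in> set (THE p. p \<in> S)}. {\<omega>\<in>space lpp_measure. A \<omega> = S})"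
    by (auto simp: subtree_vertices_def geodesic_def A_def)
  also have "\<dots> \<in> sets lpp_measure"
    by (intro sets.finite_UN) (auto simp: finite_directed_paths)
  finally show ?thesis .
qed

lemma bounded_embed_iff: "bounded (embed ` S) \<longleftrightarrow> (\<exists>K. \<forall>z\<in>S. fst z + snd z \<le> K)"
proof
  assume "bounded (embed ` S)"
  then obtain B where B: "\<And>z. z \<in> S \<Longrightarrow> norm (embed z) \<le> B" by (auto simp: bounded_iff)
  have "fst z + snd z \<le> nat \<lceil>2 * B\<rceil>" if "z \<in> S" for z
  proof -
    have "real (fst z) \<le> norm (embed z)" "real (snd z) \<le> norm (embed z)"
      using norm_fst_le[of "real (fst z)" "real (snd z)"] norm_snd_le[of "real (snd z)" "real (fst z)"] by (auto simp: embed_def)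
    with B[OF that] have "real (fst z + snd z) \<le> 2 * B" by simp
    then show ?thesis by linarith
  qed
  then show "\<exists>K. \<forall>z\<in>S. fst z + snd z \<le> K" by blast
next
  assume "\<exists>K. \<forall>z\<in>S. fst z + snd z \<le> K"
  then obtain K where "\<forall>z\<in>S. fst z + snd z \<le> K" by blast
  then have "S \<subseteq> {..K} \<times> {..K}" by (force simp: mem_Times_iff)
  then have "finite S" by (rule finite_subset) simp
  then show "bounded (embed ` S)" by (intro finite_imp_bounded finite_imageI)
qed

lemma sets_coexistence: "{\<omega>\<in>space lpp_measure. coexistence n \<omega>} \<in> sets lpp_measure"
proof -
  have "coexistence n \<omega> \<longleftrightarrow>
      (\<forall>i\<in>{..<n}. \<forall>K. \<exists>z. z \<in> subtree_vertices \<omega> (i, n - 1 - i) \<and> K < fst z + snd z)" for \<omega>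
    unfolding coexistence_def bounded_embed_iff by (auto simp: not_le Bex_def)
  then show ?thesis
    by (simp only:) (intro sets.sets_Collect_finite_All sets.sets_Collect_countable_All
        sets.sets_Collect_countable_Ex sets.sets_Collect_conj sets_subtree_vertices finite_lessThan sets.sets_Collect_const)
qed

section \<open>Positive probability of coexistence\<close>

text \<open>Filling with zeros, an admissible weight, turns a partial configuration into a point of
  the full space, where the events below are defined.\<close>

definition mask :: "site set \<Rightarrow> (site \<Rightarrow> real) \<Rightarrow> site \<Rightarrow> real" where
  "mask A \<omega> = (\<lambda>z. if z \<in> A then \<omega> z else 0)"

lemma mask_measurable_PiM: "mask A \<in> measurable (PiM A (\<lambda>_. exp1_measure)) lpp_measure"
proof -
  have "(\<lambda>\<omega>. \<lambda>z\<in>UNIV. mask A \<omega> z) \<in> measurable (PiM A (\<lambda>_. exp1_measure)) lpp_measure"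
    unfolding lpp_measure_def
  proof (rule measurable_restrict)
    fix z
    show "(\<lambda>\<omega>. mask A \<omega> z) \<in> measurable (PiM A (\<lambda>_. exp1_measure)) exp1_measure"
      by (cases "z \<in> A") (auto simp: mask_def space_exp1_measure intro: measurable_component_singleton)
  qed
  then show ?thesis by (simp add: restrict_UNIV)
qed

text \<open>Invariance under masking expresses that \<open>E\<close> and \<open>F\<close> are
  determined by the weights in \<open>A\<close> and in \<open>B\<close>.\<close>

lemma prob_disjoint_sites:
  assumes "A \<inter> B = {}" and "E \<in> sets lpp_measure" "F \<in> sets lpp_measure"
    and "\<And>\<omega>. \<omega> \<in> space lpp_measure \<Longrightarrow> mask A \<omega> \<in> E \<longleftrightarrow> \<omega> \<in> E"
    and "\<And>\<omega>. \<omega> \<in> space lpp_measure \<Longrightarrow> mask B \<omega> \<in> F \<longleftrightarrow> \<omega> \<in> F"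
  shows "measure lpp_measure (E \<inter> F) = measure lpp_measure E * measure lpp_measure F"
proof -
  have "lpp.indep_var lpp_measure (mask A) lpp_measure (mask B)"
    by (rule indep_var_disjoint_sites[OF assms(1) mask_measurable_PiM mask_measurable_PiM])
      (auto simp: mask_def)
  from lpp.prob_indep_var[OF this assms(2,3)]
  have *: "\<P>(\<omega> in lpp_measure. mask A \<omega> \<in> E \<and> mask B \<omega> \<in> F)
      = \<P>(\<omega> in lpp_measure. mask A \<omega> \<in> E) * \<P>(\<omega> in lpp_measure. mask B \<omega> \<in> F)" .
  have "{\<omega>\<in>space lpp_measure. mask A \<omega> \<in> E \<and> mask B \<omega> \<in> F} = E \<inter> F"
    "{\<omega>\<in>space lpp_measure. mask A \<omega> \<in> E} = E" "{\<omega>\<in>space lpp_measure. mask B \<omega> \<in> F} = F"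
    using assms(4,5) sets.sets_into_space[OF assms(2)] sets.sets_into_space[OF assms(3)] by auto
  with * show ?thesis by simp
qed

lemma lp_start_cong:
  assumes "\<And>z. z \<noteq> (x, y) \<Longrightarrow> x \<le> fst z \<Longrightarrow> y \<le> snd z \<Longrightarrow> \<omega> z = \<omega>' z"
  shows "lp \<omega> x y k l - \<omega> (x, y) = lp \<omega>' x y k l - \<omega>' (x, y)"
proof -
  have "lp \<omega> (Suc x) y k l = lp \<omega>' (Suc x) y k l" "lp \<omega> x (Suc y) k l = lp \<omega>' x (Suc y) k l" for k l
    by (rule lp_cong, rule assms; auto)+
  then show ?thesis by (cases k; cases l) simp_all
qed

lemma gap_cong:
  assumes "\<And>z. x + y + 1 < fst z + snd z \<Longrightarrow> \<omega> z = \<omega>' z"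
  shows "gap \<omega> X Y x y = gap \<omega>' X Y x y"
proof -
  have "\<omega> z = \<omega>' z" if "z \<noteq> (a, b)" "a \<le> fst z" "b \<le> snd z" "a + b = x + y + 1" for z a b
    using that by (intro assms) (cases z, auto)
  then show ?thesis
    unfolding gap_def lpt_def by (intro arg_cong2[where f="(-)"] lp_start_cong) auto
qed

lemma prob_coordinate_interval_pos:
  assumes "0 \<le> c"
  shows "0 < \<P>(\<omega> in lpp_measure. c \<le> \<omega> z \<and> \<omega> z \<le> c + 1)"
proof -
  have "exp (- (c + 1)) < exp (- c)" by simp
  also have "exp (- c) = \<P>(\<omega> in lpp_measure. c < \<omega> z)"
    using lpp.exponential_distributedD_gt[OF distributed_coordinate assms] by simp
  also have "\<dots> \<le> measure lpp_measure ({\<omega>\<in>space lpp_measure. c \<le> \<omega> z \<and> \<omega> z \<le> c + 1}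
      \<union> {\<omega>\<in>space lpp_measure. c + 1 < \<omega> z})"
    by (intro lpp.finite_measure_mono) auto
  also have "\<dots> \<le> \<P>(\<omega> in lpp_measure. c \<le> \<omega> z \<and> \<omega> z \<le> c + 1) + \<P>(\<omega> in lpp_measure. c + 1 < \<omega> z)"
    by (intro measure_Un_le) measurable
  also have "\<P>(\<omega> in lpp_measure. c + 1 < \<omega> z) = exp (- (c + 1))"
    using lpp.exponential_distributedD_gt[OF distributed_coordinate, of "c + 1"] assms by simp
  finally show ?thesis by simp
qed

lemma prob_finite_sites_pos:
  assumes "finite J" "\<And>z. z \<in> J \<Longrightarrow> 0 \<le> c z"
  shows "0 < \<P>(\<omega> in lpp_measure. \<forall>z\<in>J. c z \<le> \<omega> z \<and> \<omega> z \<le> c z + 1)"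
proof (cases "J = {}")
  case True then show ?thesis by (simp add: lpp.prob_space)
next
  case False
  have ind: "lpp.indep_vars (\<lambda>_. borel) (\<lambda>z \<omega>. \<omega> z) J"
    using lpp.indep_vars_compose2[OF lpp.indep_vars_subset[OF indep_vars_coordinates subset_UNIV],
        of J "\<lambda>_ x. x" "\<lambda>_. borel"] id_measurable_exp1 by simp
  have "\<P>(\<omega> in lpp_measure. \<forall>z\<in>J. c z \<le> \<omega> z \<and> \<omega> z \<le> c z + 1)
      = measure lpp_measure (\<Inter>z\<in>J. (\<lambda>\<omega>. \<omega> z) -` {c z..c z + 1} \<inter> space lpp_measure)"
    using False by (intro arg_cong[where f="measure lpp_measure"]) auto
  also have "\<dots> = (\<Prod>z\<in>J. measure lpp_measure ((\<lambda>\<omega>. \<omega> z) -` {c z..c z + 1} \<inter> space lpp_measure))"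
    using False assms(1) by (intro lpp.indep_varsD_finite[OF ind]) auto
  also have "\<dots> = (\<Prod>z\<in>J. \<P>(\<omega> in lpp_measure. c z \<le> \<omega> z \<and> \<omega> z \<le> c z + 1))"
    by (intro prod.cong refl arg_cong[where f="measure lpp_measure"]) auto
  also have "0 < \<dots>" using assms(2) by (intro prod_pos prob_coordinate_interval_pos) auto
  finally show ?thesis .
qed

lemma unimodal_separation:
  fixes G :: "nat \<Rightarrow> real" and d :: real
  assumes d: "0 \<le> d" and i: "i \<le> N"
    and up: "\<And>a. a < i \<Longrightarrow> G a + d < G (Suc a)"
    and down: "\<And>a. i \<le> a \<Longrightarrow> a < N \<Longrightarrow> G (Suc a) + d < G a"
    and a: "a \<le> N" "a \<noteq> i"
  shows "G a + d < G i"
proof (cases "a < i")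
  case True
  then show ?thesis
  proof (induction rule: strict_inc_induct)
    case (base j) then show ?case using up[of j] by simp
  next
    case (step j) then show ?case using up[of j] d by simp
  qed
next
  case False
  with a have "i < a" by simp
  then show ?thesis using a(1)
  proof (induction a)
    case (Suc b)
    then show ?case using down[of b] d by (cases "b = i") auto
  qed simp
qed

text \<open>The intervals are built one after another, each lower end lying \<open>d\<close> above
  the previous upper end; \<open>x \<le> g x\<close> makes both ends monotone, which extends the
  separation to all pairs.\<close>

lemma increasing_thresholds:
  fixes g :: "real \<Rightarrow> real" and d :: real
  assumes "\<And>x. x \<le> g x" "0 \<le> d"
  shows "\<exists>A B :: nat \<Rightarrow> real. (\<forall>i. B i = g (A i)) \<and> (\<forall>i j. i < j \<longrightarrow> B i + d \<le> A j)
    \<and> (\<forall>i j. i \<le> j \<longrightarrow> B i \<le> B j) \<and> (\<forall>i. 0 \<le> B i)"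
proof -
  define A :: "nat \<Rightarrow> real" where "A = rec_nat 0 (\<lambda>_ x. g x + d)"
  have A: "A 0 = 0" "A (Suc i) = g (A i) + d" for i by (simp_all add: A_def)
  have step: "A i \<le> A (Suc i)" "g (A i) \<le> g (A (Suc i))" for i
    using assms(1)[of "A i"] assms(1)[of "A (Suc i)"] assms(2) by (simp_all add: A)
  have monoA: "A i \<le> A j" if "i \<le> j" for i j by (rule lift_Suc_mono_le[of A, OF step(1) that])
  have monoB: "g (A i) \<le> g (A j)" if "i \<le> j" for i j
    by (rule lift_Suc_mono_le[of "\<lambda>i. g (A i)", OF step(2) that])
  show ?thesis
  proof (rule exI[of _ A], rule exI[of _ "\<lambda>i. g (A i)"], intro conjI allI impI)
    show "g (A i) + d \<le> A j" if "i < j" for i j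
      using monoA[of "Suc i" j] that by (simp add: A)
    show "0 \<le> g (A i)" for i using monoB[of 0 i] assms(1)[of 0] by (simp add: A)
  qed (use monoB in auto)
qed

theorem theorem3:
  fixes n :: nat
  assumes "n \<ge> 1"
  shows "\<P>(\<omega> in lpp_measure. coexistence n \<omega>) > 0"
proof -
  define N where "N = n - 1"
  \<comment> \<open>A union bound over the \<open>n\<close> targets leaves probability at least
    1/2.\<close>
  define \<epsilon> where "\<epsilon> = 1 / (2 * real n)"
  have \<epsilon>: "0 < \<epsilon>" using assms by (simp add: \<epsilon>_def)
  define good where "good R R' X Y = {\<omega>\<in>space lpp_measure.
      \<forall>a<N. R < gap \<omega> X Y a (N - 1 - a) \<and> gap \<omega> X Y a (N - 1 - a) < R'}" for R R' X Y
  have good[measurable]: "good R R' X Y \<in> sets lpp_measure" for R R' X Y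
    unfolding good_def by measurable
  have "\<forall>R. \<exists>R'. R \<le> R' \<and> (\<forall>K. \<exists>X Y. K \<le> X \<and> K \<le> Y \<and> 1 - \<epsilon> \<le> measure lpp_measure (good R R' X Y))"
  proof
    fix R
    obtain R' where R': "\<forall>K. \<exists>X Y. K \<le> X \<and> K \<le> Y \<and> 1 - \<epsilon> \<le> measure lpp_measure (good R R' X Y)"
      using gaps_between_with_high_probability[OF \<epsilon>, of N R] unfolding good_def by blast
    have mono: "measure lpp_measure (good R R' X Y) \<le> measure lpp_measure (good R (max R R') X Y)" for X Y
      by (intro lpp.finite_measure_mono good) (auto simp: good_def)
    have "\<exists>X Y. K \<le> X \<and> K \<le> Y \<and> 1 - \<epsilon> \<le> measure lpp_measure (good R (max R R') X Y)" for K
    proof -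
      obtain X Y where "K \<le> X" "K \<le> Y" "1 - \<epsilon> \<le> measure lpp_measure (good R R' X Y)"
        using R' by blast
      with mono[of X Y] show ?thesis by (intro exI conjI) (assumption, assumption, linarith)
    qed
    then show "\<exists>R'. R \<le> R' \<and> (\<forall>K. \<exists>X Y. K \<le> X \<and> K \<le> Y \<and> 1 - \<epsilon> \<le> measure lpp_measure (good R R' X Y))"
      by (intro exI[of _ "max R R'"]) auto
  qed
  from choice[OF this] obtain g where g': "\<forall>R. R \<le> g R
    \<and> (\<forall>K. \<exists>X Y. K \<le> X \<and> K \<le> Y \<and> 1 - \<epsilon> \<le> measure lpp_measure (good R (g R) X Y))" ..
  then have g: "R \<le> g R" "\<exists>X Y. K \<le> X \<and> K \<le> Y \<and> 1 - \<epsilon> \<le> measure lpp_measure (good R (g R) X Y)"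
    for R K
    by simp_all
  \<comment> \<open>The separation is made of \<open>N + 1\<close> in the height steps, 1 for the
    play in the weights, and the margin \<open>N\<close> required by
    \<open>maximal_path_through\<close>.\<close>
  have "0 \<le> 2 * (real N + 1)" by simp
  from increasing_thresholds[of g, OF g(1) this] obtain A B :: "nat \<Rightarrow> real" where
    AB': "(\<forall>i. B i = g (A i)) \<and> (\<forall>i j. i < j \<longrightarrow> B i + 2 * (real N + 1) \<le> A j)
    \<and> (\<forall>i j. i \<le> j \<longrightarrow> B i \<le> B j) \<and> (\<forall>i. 0 \<le> B i)"
    by (elim exE)
  then have AB: "B i = g (A i)" "i < j \<Longrightarrow> B i + 2 * (real N + 1) \<le> A j"
    "i \<le> j \<Longrightarrow> B i \<le> B j" "0 \<le> B i" for i j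
    by blast+
  have "\<forall>q. \<exists>v. snd q \<le> fst v \<and> snd q \<le> snd v
      \<and> 1 - \<epsilon> \<le> measure lpp_measure (good (A (fst q)) (B (fst q)) (fst v) (snd v))"
  proof
    fix q
    obtain X Y where "snd q \<le> X" "snd q \<le> Y"
      "1 - \<epsilon> \<le> measure lpp_measure (good (A (fst q)) (B (fst q)) X Y)"
      using g(2) unfolding AB(1) by blast
    then show "\<exists>v. snd q \<le> fst v \<and> snd q \<le> snd v
        \<and> 1 - \<epsilon> \<le> measure lpp_measure (good (A (fst q)) (B (fst q)) (fst v) (snd v))"
      by (intro exI[of _ "(X, Y)"]) simp
  qed
  from choice[OF this] obtain T' :: "nat \<times> nat \<Rightarrow> site" where
    T': "\<forall>q. snd q \<le> fst (T' q) \<and> snd q \<le> snd (T' q)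
      \<and> 1 - \<epsilon> \<le> measure lpp_measure (good (A (fst q)) (B (fst q)) (fst (T' q)) (snd (T' q)))"
    by blast
  define T where "T i K = T' (i, K)" for i K
  have T: "K \<le> fst (T i K)" "K \<le> snd (T i K)"
    "1 - \<epsilon> \<le> measure lpp_measure (good (A i) (B i) (fst (T i K)) (snd (T i K)))" for i K
    using T'[rule_format, of "(i, K)"] by (simp_all add: T_def)
  \<comment> \<open>The drop \<open>B a + N + 1\<close> from \<open>a\<close> to
    \<open>Suc a\<close> exceeds all gaps aimed at targets \<open>i \<le> a\<close> and falls short
    of those for \<open>i > a\<close>. It increases with \<open>a\<close>, so the heights are
    concave.\<close>
  define h where "h a = (\<Sum>c=a..<N. B c + real N + 1)" for a
  have h0: "0 \<le> h a" for a
    unfolding h_def using AB(4) by (intro sum_nonneg) (simp add: add_nonneg_nonneg)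
  have h_step: "h a = h (Suc a) + (B a + real N + 1)" if "a < N" for a
    unfolding h_def using that by (simp add: sum.atLeast_Suc_lessThan)
  define low where "low = {z :: site. fst z + snd z \<le> N}"
  define c where "c z = (if fst z + snd z < N then 0 else h (fst z))" for z :: site
  define E where "E = {\<omega>\<in>space lpp_measure. \<forall>z\<in>low. c z \<le> \<omega> z \<and> \<omega> z \<le> c z + 1}"
  have fin: "finite low"
    by (rule finite_subset[of _ "{..N} \<times> {..N}"]) (auto simp: low_def)
  have E[measurable]: "E \<in> sets lpp_measure"
    unfolding E_def by (intro sets.sets_Collect_finite_All fin) measurable
  have Epos: "0 < measure lpp_measure E"
    unfolding E_def using fin h0 by (intro prob_finite_sites_pos) (auto simp: c_def)
  \<comment> \<open>The offset \<open>N\<close> puts every target beyond the whole antidiagonal;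
    \<open>M\<close> sends the targets to infinity.\<close>
  define F where "F M = (\<Inter>i<n. good (A i) (B i) (fst (T i (N + M))) (snd (T i (N + M))))" for M
  have F[measurable]: "F M \<in> sets lpp_measure" for M
    unfolding F_def using assms by (intro sets.finite_INT) (auto simp: lessThan_empty_iff)
  have Fprob: "1 / 2 \<le> measure lpp_measure (F M)" for M
  proof -
    let ?G = "\<lambda>i. good (A i) (B i) (fst (T i (N + M))) (snd (T i (N + M)))"
    have "measure lpp_measure (space lpp_measure - ?G i) \<le> \<epsilon>" for i
      using T(3)[of i "N + M"] by (subst lpp.prob_compl) auto
    then have "measure lpp_measure (\<Union>i<n. space lpp_measure - ?G i) \<le> n * \<epsilon>"
      by (intro measure_bad_union_le) auto
    also have "\<dots> = 1 / 2" using assms by (simp add: \<epsilon>_def)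
    finally have "measure lpp_measure (\<Union>i<n. space lpp_measure - ?G i) \<le> 1 / 2" .
    moreover have "(\<Union>i<n. space lpp_measure - ?G i) \<in> sets lpp_measure"
      by (intro sets.finite_UN sets.compl_sets good) simp
    ultimately have "1 / 2 \<le> measure lpp_measure (space lpp_measure - (\<Union>i<n. space lpp_measure - ?G i))"
      using lpp.prob_compl[of "\<Union>i<n. space lpp_measure - ?G i"] by linarith
    also have "space lpp_measure - (\<Union>i<n. space lpp_measure - ?G i) = F M"
      using sets.sets_into_space[OF F[of M]] unfolding F_def by blast
    finally show ?thesis .
  qed
  \<comment> \<open>\<open>E\<close> prescribes the weights up to the antidiagonal \<open>N\<close>,
    while the gaps in \<open>F M\<close> see only those beyond it.\<close>
  have EF: "measure lpp_measure (E \<inter> F M) = measure lpp_measure E * measure lpp_measure (F M)" for M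
  proof (rule prob_disjoint_sites)
    show "low \<inter> - low = {}" by simp
    show "mask low \<omega> \<in> E \<longleftrightarrow> \<omega> \<in> E" if "\<omega> \<in> space lpp_measure" for \<omega>
      using that by (auto simp: E_def mask_def space_lpp_measure)
    show "mask (- low) \<omega> \<in> F M \<longleftrightarrow> \<omega> \<in> F M" if \<omega>: "\<omega> \<in> space lpp_measure" for \<omega>
    proof -
      have "gap (mask (- low) \<omega>) X Y a (N - 1 - a) = gap \<omega> X Y a (N - 1 - a)" if "a < N" for X Y a
        using that by (intro gap_cong) (auto simp: mask_def low_def)
      moreover have "mask (- low) \<omega> \<in> space lpp_measure"
        using \<omega> by (auto simp: mask_def space_lpp_measure)
      ultimately show ?thesis using \<omega> by (auto simp: F_def good_def)
    qed
  qed (rule E F)+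
  have in_subtree: "T i (N + M) \<in> subtree_vertices \<omega> (i, N - i)"
    if \<omega>: "\<omega> \<in> E \<inter> F M" and dist: "distinct_passage_times \<omega>" and i: "i < n" for \<omega> M i
  proof -
    define X Y where "X = fst (T i (N + M))" and "Y = snd (T i (N + M))"
    have XY: "N \<le> X" "N \<le> Y" using T(1,2)[of "N + M" i] by (auto simp: X_def Y_def)
    have iN: "i \<le> N" using i by (simp add: N_def)
    have nonneg: "0 \<le> \<omega> z" for z using \<omega> by (auto simp: E_def intro: coordinate_nonneg)
    have lowE: "c z \<le> \<omega> z" "\<omega> z \<le> c z + 1" if "fst z + snd z \<le> N" for z
    proof -
      have "c z \<le> \<omega> z \<and> \<omega> z \<le> c z + 1" using \<omega> that unfolding E_def low_def by blast
      then show "c z \<le> \<omega> z" "\<omega> z \<le> c z + 1" by auto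
    qed
    have gap: "A i < gap \<omega> X Y a (N - 1 - a)" "gap \<omega> X Y a (N - 1 - a) < B i" if "a < N" for a
      using \<omega> i that by (auto simp: F_def good_def X_def Y_def)
    define G where "G a = lpt \<omega> X Y a (N - a)" for a
    have G: "G (Suc a) - G a = gap \<omega> X Y a (N - 1 - a) + \<omega> (Suc a, N - Suc a) - \<omega> (a, N - a)"
      if "a < N" for a
      using that by (simp add: G_def gap_def Suc_diff_Suc)
    have h: "h a \<le> \<omega> (a, N - a)" "\<omega> (a, N - a) \<le> h a + 1" if "a \<le> N" for a
      using lowE[of "(a, N - a)"] that by (auto simp: c_def)
    \<comment> \<open>Up to an error of at most 1, the increment of \<open>G\<close> at
      \<open>a\<close> is the gap minus \<open>B a + N + 1\<close>. It exceeds \<open>N\<close> for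
      \<open>a < i\<close>, where the gap is above \<open>A i \<ge> B a + 2 * (N + 1)\<close>, and
      is below \<open>- N\<close> for \<open>i \<le> a\<close>, where the gap is below
      \<open>B i \<le> B a\<close>. So \<open>G\<close> peaks at \<open>i\<close>.\<close>
    have "G a + N < G i" if "a \<le> N" "a \<noteq> i" for a
    proof (rule unimodal_separation[where N=N and i=i])
      show "G a + N < G (Suc a)" if "a < i" for a
      proof -
        have "a < N" using that iN by simp
        then show ?thesis
          using G[of a] gap(1)[of a] h(2)[of a] h(1)[of "Suc a"] h_step[of a] AB(2)[OF that] by simp
      qed
      show "G (Suc a) + N < G a" if "i \<le> a" "a < N" for a
        using G[of a] gap(2)[of a] h(1)[of a] h(2)[of "Suc a"] h_step[of a] AB(3)[OF that(1)] that(2) by simp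
    qed (use that iN in auto)
    moreover have "\<omega> z \<le> 1" if "fst z + snd z < N" for z
      using lowE(2)[of z] that by (simp add: c_def)
    ultimately have "(i, N - i) \<in> set (geodesic \<omega> (X, Y))"
      using XY iN nonneg geodesic_maximal[OF dist, of "(X, Y)"]
      by (intro maximal_path_through[of \<omega> N i X Y]) (auto simp: G_def)
    then show ?thesis by (simp add: subtree_vertices_def X_def Y_def)
  qed
  \<comment> \<open>Continuity from above: \<open>E \<inter> F M\<close> occurs for infinitely many
    \<open>M\<close> with probability at least half that of \<open>E\<close>.\<close>
  define V where "V m = (\<Union>M\<in>{m..}. E \<inter> F M)" for m
  have V: "V m \<in> sets lpp_measure" for m unfolding V_def by (intro sets.countable_UN') auto
  have "(\<lambda>m. measure lpp_measure (V m)) \<longlonglongrightarrow> measure lpp_measure (\<Inter>m. V m)"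
  proof (rule lpp.finite_Lim_measure_decseq)
    show "decseq V" unfolding V_def decseq_def by (intro allI impI UN_mono) auto
  qed (use V in auto)
  moreover have "measure lpp_measure E * (1 / 2) \<le> measure lpp_measure (V m)" for m
  proof -
    have "measure lpp_measure E * (1 / 2) \<le> measure lpp_measure (E \<inter> F m)"
      unfolding EF by (intro mult_left_mono Fprob) simp
    also have "\<dots> \<le> measure lpp_measure (V m)"
      by (intro lpp.finite_measure_mono V) (auto simp: V_def)
    finally show ?thesis .
  qed
  ultimately have "measure lpp_measure E * (1 / 2) \<le> measure lpp_measure (\<Inter>m. V m)"
    by (intro LIMSEQ_le_const) auto
  also have "\<dots> \<le> \<P>(\<omega> in lpp_measure. coexistence n \<omega>)"
  proof (rule lpp.finite_measure_mono_AE[OF _ sets_coexistence])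
    show "AE \<omega> in lpp_measure. \<omega> \<in> (\<Inter>m. V m) \<longrightarrow> \<omega> \<in> {\<omega>\<in>space lpp_measure. coexistence n \<omega>}"
      using AE_distinct_passage_times AE_space
    proof eventually_elim
      fix \<omega> assume dist: "distinct_passage_times \<omega>" and sp: "\<omega> \<in> space lpp_measure"
      show "\<omega> \<in> (\<Inter>m. V m) \<longrightarrow> \<omega> \<in> {\<omega>\<in>space lpp_measure. coexistence n \<omega>}"
      proof
        assume \<omega>: "\<omega> \<in> (\<Inter>m. V m)"
        have "\<not> bounded (embed ` subtree_vertices \<omega> (i, n - 1 - i))" if "i < n" for i
          unfolding bounded_embed_iff
        proof
          assume "\<exists>K. \<forall>z\<in>subtree_vertices \<omega> (i, n - 1 - i). fst z + snd z \<le> K"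
          then obtain K where K: "\<And>z. z \<in> subtree_vertices \<omega> (i, n - 1 - i) \<Longrightarrow> fst z + snd z \<le> K"
            by blast
          \<comment> \<open>Some \<open>M > K\<close> puts into the subtree a target whose first
            coordinate is at least \<open>N + M\<close>.\<close>
          from \<omega> have "\<omega> \<in> V (Suc K)" by blast
          then obtain M where M: "Suc K \<le> M" "\<omega> \<in> E \<inter> F M" by (auto simp: V_def)
          from K[of "T i (N + M)"] in_subtree[OF M(2) dist that] have "fst (T i (N + M)) \<le> K"
            by (simp add: N_def)
          with T(1)[of "N + M" i] M(1) show False by simp
        qed
        with sp show "\<omega> \<in> {\<omega>\<in>space lpp_measure. coexistence n \<omega>}" by (simp add: coexistence_def)
      qed
    qed
  qed
  finally show ?thesis using Epos by simp
qed

end
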